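(* Let $(x_n)_{n\ge0}$ be the $\mathbb R^d$-valued iterates $x_{n+1}=x_n+a(n)[h(x_n)+M_{n+1}]$, let $V$, $H$ be as in the context, and let $B$ be a bounded open set with $H\subset B$. Assume: (A1) $h:\mathbb R^d\to\mathbb R^d$ is Lipschitz; (A2) $a(n)>0$, $\sum_n a(n)=\infty$, $\sum_n a(n)^2<\infty$, and there is $c>0$ such that $a(n)\le c\,a(m)$ for all $n\ge m$; (A3) $(M_n)_{n\ge1}$ is a square integrable martingale difference sequence with respect to $\mathcal F_n=\sigma(x_0,M_1,\ldots,M_n)$, i.e. $E[M_{n+1}\mid\mathcal F_n]=0$ a.s. for all $n\ge0$, and $E[\|M_{n+1}\|^2\mid\mathcal F_n]\le c(1+\|x_n\|^2)$ a.s. for all $n\ge 0$ and some $0<c<\infty$; (step sizes) there is a positive constant $\gamma_T$ depending only on $T$ such that $a(n_i+m_1)/a(n_i+m_2)<\gamma_T$ whenever $n_i\le n_i+m_1,\,n_i+m_2<n_{i+1}$, for the indices $n_i$ defined in the context; (tail bound) there are positive constants $C_1,C_2$ such that, for all $v$ large enough and all $i\ge0$, $$\mathbb P\left[\left.\frac{\|M_{i+1}\|}{1+\|x_i\|}>v\right|\mathcal F_i\right]\le C_1\exp(-C_2v)\quad\text{a.s.}$$ Let $\epsilon,\Delta,\delta>0$ be as in the context, where $\delta=\delta_B/2K_T$, and set $$\gamma=\frac{\max_{x\in\bar B}V(x)-\epsilon}{\Delta/2}\times(T+1).$$ Then there are positive constants $c_1,c$, not depending on $n_0$, such that, provided $n_0$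 is sufficiently large, with $t_0=t(n_0)$ and $b(n_0)=\sum_{m=n_0}^\infty a(m)^2$, $$\mathbb P\left[\bar x(t)\in N_\delta(H^{\epsilon+\Delta/2})\ \ \forall t\ge t_0+\gamma\ \middle|\ x_{n_0}\in B\right]\ \ge\ 1-c_1\exp\left(-\frac{c\,\delta^{2/3}}{\sqrt[4]{b(n_0)}}\right).$$
   Context: $V:\mathbb R^d\to[0,\infty)$ is differentiable with $\lim_{\|x\|\uparrow\infty}V(x)=\infty$ and $\nabla V(x)\cdot h(x)\le 0$ for all $x$. $H:=\{x:\nabla V(x)\cdot h(x)=0\}$ is assumed to coincide with $\{x:V(x)=0\}$ (so $H$ is compact). Fix $T\in(0,\infty)$. Let $t(n)=\sum_{i=0}^{n-1}a(i)$. For $n_0\ge0$ define $n_i=\min\{n:t(n)\ge t(n_{i-1})+T\}$, $i\ge1$. Let $\bar x(\cdot)$ be given by $\bar x(t(n))=x_n$ with linear interpolation on each $[t(n),t(n+1)]$. Let $x^{t(n_i)}(\cdot)$ be the solution on $[t(n_i),t(n_{i+1}))$ of the o.d.e. $\dot x(t)=h(x(t))$ with $x^{t(n_i)}(t(n_i))=x_{n_i}$, and let $\rho_i:=\sup_{t\in[t(n_i),t(n_{i+1}))}\|\bar x(t)-x^{t(n_i)}(t)\|$. $\delta_B>0$ is a constant (not depending on $i$ or $n_0$) such that if $x_{n_i}\in B$ and $\rho_i<\delta_B$ then $x_{n_{i+1}}\in B$. For $i\ge0$, $\mathcal B_i$ is the event that $x_{n_0}\in B$ and $\rho_k<\delta_B$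 for $k=0,\ldots,i$; $\mathcal B_{-1}$ is the event $x_{n_0}\in B$. $K_T>0$ is a constant depending only on $T$ such that, with $\delta=\delta_B/2K_T$, for all $n_0$ sufficiently large and all $i\ge0$, $$\mathbb P[\rho_i\ge\delta_B\mid\mathcal B_{i-1}]\le\mathbb P\Big[\max_{0\le j<n_{i+1}-n_i}\Big\|\sum_{m=0}^{j}a(n_i+m)M_{n_i+m+1}\Big\|>\delta\ \Big|\ \mathcal B_{i-1}\Big].$$ (The existence of such $\delta_B$ and $K_T$ is recalled from earlier literature and is part of the setting.) For $r>0$, $H^r:=\{x:V(x)<r\}$ and $\bar H^r:=\{x:V(x)\le r\}$; $N_\delta(A)$ is the $\delta$-neighborhood of $A$. Fix $\epsilon>0$ with $H^\epsilon\subset\bar H^\epsilon\subset B$. $\Delta>0$ is such that if the o.d.e. $\dot x(t)=h(x(t))$ starts from $x\in\bar B\setminus H^\epsilon$, flows for any time greater than $T$ and reaches $y$, then $V(y)<V(x)-\Delta$. $\delta>0$ is such that $N_\delta(H^\epsilon)\subset B$ and $|V(x)-V(y)|<\Delta/2$ for all $x,y\in\bar B$ with $\|x-y\|<\delta$. Conditional probabilities given an event are considered when that event has positive probability. *)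

theory Defs
  imports "HOL-Probability.Probability"
begin

definition sa_time :: "(nat \<Rightarrow> real) \<Rightarrow> nat \<Rightarrow> real" where
  "sa_time a n = (\<Sum>i<n. a i)"

(* block_start a T n0 i is the index n_i; the minimum exists because sa_time a diverges. *)
primrec block_start :: "(nat \<Rightarrow> real) \<Rightarrow> real \<Rightarrow> nat \<Rightarrow> nat \<Rightarrow> nat" where
  "block_start a T n0 0 = n0"
| "block_start a T n0 (Suc i) =
     (LEAST n. sa_time a n \<ge> sa_time a (block_start a T n0 i) + T)"

(* For t \<ge> 0 the index n chosen here is the one with sa_time a n \<le> t < sa_time a (Suc n),
   and sa_time a (Suc n) - sa_time a n = a n. *)
definition interpolate :: "(nat \<Rightarrow> real) \<Rightarrow> (nat \<Rightarrow> 'v::real_vector) \<Rightarrow> real \<Rightarrow> 'v" where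
  "interpolate a z t =
     (let n = (LEAST n. t < sa_time a (Suc n))
      in z n + ((t - sa_time a n) / a n) *\<^sub>R (z (Suc n) - z n))"

definition solves_ode_on :: "('v::real_normed_vector \<Rightarrow> 'v) \<Rightarrow> (real \<Rightarrow> 'v) \<Rightarrow> real set \<Rightarrow> bool" where
  "solves_ode_on h y S \<longleftrightarrow> (\<forall>t\<in>S. (y has_vector_derivative h (y t)) (at t within S))"

(* Value at time t \<ge> s of the solution started from z at time s; for Lipschitz h the solution
   exists and is unique on every {s..t}, so the description is proper. *)
definition ode_value :: "('v::real_normed_vector \<Rightarrow> 'v) \<Rightarrow> real \<Rightarrow> 'v \<Rightarrow> real \<Rightarrow> 'v" where
  "ode_value h s z t = (THE w. \<exists>y. solves_ode_on h y {s..t} \<and> y s = z \<and> y t = w)"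

(* The quantity rho_i of one sample path z. *)
definition block_error ::
  "(nat \<Rightarrow> real) \<Rightarrow> real \<Rightarrow> ('v::real_normed_vector \<Rightarrow> 'v) \<Rightarrow> (nat \<Rightarrow> 'v) \<Rightarrow> nat \<Rightarrow> nat \<Rightarrow> real" where
  "block_error a T h z n0 i =
     (let n = block_start a T n0 i; n' = block_start a T n0 (Suc i)
      in SUP t\<in>{sa_time a n..<sa_time a n'}.
           norm (interpolate a z t - ode_value h (sa_time a n) (z n) t))"

(* Shifted index: good_before ... i is the event called B_(i-1), for i \<ge> 0. *)
definition good_before ::
  "'v set \<Rightarrow> real \<Rightarrow> (nat \<Rightarrow> real) \<Rightarrow> real \<Rightarrow> ('v::real_normed_vector \<Rightarrow> 'v) \<Rightarrow> (nat \<Rightarrow> 'v)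
     \<Rightarrow> nat \<Rightarrow> nat \<Rightarrow> bool" where
  "good_before B \<delta>B a T h z n0 i \<longleftrightarrow> z n0 \<in> B \<and> (\<forall>k<i. block_error a T h z n0 k < \<delta>B)"

(* The path m of the noise is indexed from 1; m 0 is never used. *)
definition block_noise ::
  "(nat \<Rightarrow> real) \<Rightarrow> real \<Rightarrow> (nat \<Rightarrow> 'v::real_normed_vector) \<Rightarrow> nat \<Rightarrow> nat \<Rightarrow> real" where
  "block_noise a T m n0 i =
     (let n = block_start a T n0 i; n' = block_start a T n0 (Suc i)
      in MAX j\<in>{0..<n' - n}. norm (\<Sum>k=0..j. a (n + k) *\<^sub>R m (n + k + 1)))"

(* The sigma-algebra generated by x 0, M 1, ..., M n (on the sample space of P). *)
definition noise_filtration ::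
  "'w measure \<Rightarrow> (nat \<Rightarrow> 'w \<Rightarrow> 'v::topological_space) \<Rightarrow> (nat \<Rightarrow> 'w \<Rightarrow> 'v) \<Rightarrow> nat \<Rightarrow> 'w measure" where
  "noise_filtration P x M n =
     sigma (space P)
       ({x 0 -` A \<inter> space P | A. A \<in> sets borel} \<union>
        {M k -` A \<inter> space P | k A. k \<in> {1..n} \<and> A \<in> sets borel})"

definition sublevel :: "('v \<Rightarrow> real) \<Rightarrow> real \<Rightarrow> 'v set" where
  "sublevel V r = {x. V x < r}"

definition closed_sublevel :: "('v \<Rightarrow> real) \<Rightarrow> real \<Rightarrow> 'v set" where
  "closed_sublevel V r = {x. V x \<le> r}"

definition nbhd :: "real \<Rightarrow> 'v::metric_space set \<Rightarrow> 'v set" where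
  "nbhd r A = (\<Union>y\<in>A. ball y r)"

end

theory Submission
  imports Defs
begin

text \<open>
  Time is cut into blocks of length about \<open>T\<close>, and on each block the interpolated path is compared with
  the solution of the differential equation started at the first iterate of the block.

  The deterministic part: let a block start in \<open>B\<close>, let its partial noise sums stay below a small fixed
  threshold \<open>\<eta>\<close>, and let the steps be small. By a discrete Gronwall argument the path then stays within
  \<open>\<mu>\<close> of the solution (\<open>small_noise_tracks\<close>). Outside the sublevel set of \<open>\<epsilon>\<close> the solution lowers \<open>V\<close> by at
  least \<open>\<Delta>\<close> during a block, and it never raises \<open>V\<close>. If \<open>\<mu>\<close> is so small that errors of size \<open>\<mu>\<close> change \<open>V\<close>
  by less than \<open>\<Delta> / 2\<close>, then \<open>V\<close> at the block starts drops by more than \<open>\<Delta> / 2\<close> per block until it is below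
  \<open>\<epsilon> + \<Delta> / 2\<close>, and stays below from then on. The waiting time \<open>\<gamma>\<close> is the maximal number of such drops
  times the maximal block length \<open>T + 1\<close> (\<open>tracking_implies_confinement\<close>).

  The probabilistic part: confinement can only fail if the noise exceeds \<open>\<eta>\<close> in some block that starts
  in \<open>B\<close>. The noise has exponential tails relative to \<open>1 + \<parallel>x n\<parallel>\<close>, and up to the first exceedance the
  iterates of the block are bounded by a constant, again by the Gronwall argument. So the stopped noise
  sum is a martingale with conditional exponential moments, and Chernoff's method bounds the
  probability of exceedance by \<open>K exp (- c / sqrt \<beta>)\<close>, where \<open>\<beta>\<close> is the sum of the squared steps in the
  block (\<open>block_concentration\<close>). The bound holds relative to every event of the past, hence relative to
  \<open>x n0 \<in> B\<close>, with constants that depend neither on the block nor on \<open>n0\<close>.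

  The sums \<open>\<beta>\<close> of all blocks add up to at most \<open>b(n0)\<close>, so the union bound over the blocks is a convergent
  series of size \<open>exp (- c / (2 * root 4 b(n0)))\<close> up to a constant (\<open>sum_exp_le_exp_fourth_root\<close>). As \<open>\<delta>\<close> is
  fixed, the factor \<open>\<delta> powr (2/3)\<close> is absorbed into the constant in the exponent. Here \<open>n0\<close> is large enough for
  the steps to be small and for \<open>b(n0) \<le> 1\<close>.
\<close>

section \<open>Differential equations with Lipschitz right-hand side\<close>

text \<open>
  Picard's fixed point argument in the norm weighted by \<open>exp (- \<kappa> t)\<close>: with \<open>\<kappa> = 2 (L + 1)\<close> the integral
  operator is a contraction on all of \<open>[0, S]\<close> at once, so no gluing of short-time solutions is needed.
  The fixed point \<open>u\<close> is the solution multiplied by the weight.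
\<close>
lemma ode_solution_exists:
  fixes h :: "'v::banach \<Rightarrow> 'v"
  assumes lip: "L-lipschitz_on UNIV h" and "0 \<le> S"
  shows "\<exists>y. solves_ode_on h y {0..S} \<and> y 0 = z"
proof -
  define \<kappa> where "\<kappa> = 2 * (L + 1)"
  have L0: "0 \<le> L" using lip by (rule lipschitz_on_nonneg)
  have \<kappa>: "0 < \<kappa>" using L0 by (simp add: \<kappa>_def)
  \<comment> \<open>Clamping time to \<open>[0, S]\<close> makes continuous functions on the interval bounded continuous on the line.\<close>
  define cl where "cl t = max 0 (min S t)" for t :: real
  have cl_range: "cl t \<in> {0..S}" for t using \<open>0 \<le> S\<close> by (auto simp: cl_def)
  have cl_id: "cl t = t" if "t \<in> {0..S}" for t using that by (auto simp: cl_def)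
  have cl_cont: "continuous_on UNIV cl" unfolding cl_def by (intro continuous_intros)
  have h_cont: "continuous_on A h" for A
    using lip lipschitz_on_continuous_on continuous_on_subset by blast
  define f where "f u s = h (exp (\<kappa> * s) *\<^sub>R apply_bcontfun u s)" for u :: "real \<Rightarrow>\<^sub>C 'v" and s
  have f_cont: "continuous_on A (f u)" for A u
    unfolding f_def by (intro continuous_on_compose2[OF h_cont[of UNIV]] continuous_intros) auto
  define G where "G u r = exp (- \<kappa> * r) *\<^sub>R (z + integral {0..r} (f u))" for u r
  have G_cont: "continuous_on {0..S} (G u)" for u
    unfolding G_def
    by (intro continuous_intros indefinite_integral_continuous_1 integrable_continuous_real f_cont)
  have GI: "(\<lambda>t. G u (cl t)) \<in> bcontfun" for u
  proof -
    have "continuous_on UNIV (\<lambda>t. G u (cl t))"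
      using cl_range by (intro continuous_on_compose2[OF G_cont cl_cont]) auto
    moreover have "bounded (G u ` {0..S})"
      by (intro compact_imp_bounded compact_continuous_image G_cont compact_Icc)
    then have "bounded (range (\<lambda>t. G u (cl t)))"
      by (rule bounded_subset) (use cl_range in auto)
    ultimately show ?thesis by (simp add: bcontfun_def)
  qed
  define \<Phi> where "\<Phi> u = Bcontfun (\<lambda>t. G u (cl t))" for u
  have \<Phi>: "apply_bcontfun (\<Phi> u) t = G u (cl t)" for u t
    unfolding \<Phi>_def using GI by (simp add: Bcontfun_inverse)
  have contr: "dist (\<Phi> u) (\<Phi> v) \<le> (1/2) * dist u v" for u v
  proof (rule dist_bound)
    fix t
    define r where "r = cl t"
    have r: "0 \<le> r" using cl_range[of t] by (simp add: r_def)
    have pt: "norm (f u s - f v s) \<le> L * dist u v * exp (\<kappa> * s)" for s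
    proof -
      have "norm (f u s - f v s) \<le> L * norm (exp (\<kappa> * s) *\<^sub>R (apply_bcontfun u s - apply_bcontfun v s))"
        using lipschitz_onD[OF lip, of "exp (\<kappa> * s) *\<^sub>R apply_bcontfun u s" "exp (\<kappa> * s) *\<^sub>R apply_bcontfun v s"]
        by (simp add: f_def dist_norm scaleR_diff_right)
      also have "\<dots> = L * (exp (\<kappa> * s) * dist (apply_bcontfun u s) (apply_bcontfun v s))"
        by (simp add: dist_norm)
      also have "\<dots> \<le> L * (exp (\<kappa> * s) * dist u v)"
        using L0 by (intro mult_left_mono dist_bounded) auto
      finally show ?thesis by (simp add: mult_ac)
    qed
    have I: "((\<lambda>s. L * dist u v * exp (\<kappa> * s)) has_integral
        (L * dist u v * exp (\<kappa> * r) / \<kappa> - L * dist u v * exp (\<kappa> * 0) / \<kappa>)) {0..r}"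
      using \<kappa> r by (intro fundamental_theorem_of_calculus)
        (auto intro!: derivative_eq_intros simp flip: has_real_derivative_iff_has_vector_derivative)
    have "norm (integral {0..r} (\<lambda>s. f u s - f v s)) \<le> integral {0..r} (\<lambda>s. L * dist u v * exp (\<kappa> * s))"
      by (intro integral_norm_bound_integral integrable_continuous_real continuous_intros f_cont pt)
    also have "\<dots> = L * dist u v * exp (\<kappa> * r) / \<kappa> - L * dist u v * exp (\<kappa> * 0) / \<kappa>"
      using I by (rule integral_unique)
    also have "\<dots> \<le> L * dist u v * exp (\<kappa> * r) / \<kappa>"
      using L0 \<kappa> by simp
    also have "\<dots> \<le> (1/2) * dist u v * exp (\<kappa> * r)"
    proof -
      have "L / \<kappa> \<le> 1/2" using L0 by (simp add: \<kappa>_def field_simps)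
      then have "(L / \<kappa>) * (dist u v * exp (\<kappa> * r)) \<le> (1/2) * (dist u v * exp (\<kappa> * r))"
        by (intro mult_right_mono) auto
      then show ?thesis by simp
    qed
    finally have le: "norm (integral {0..r} (\<lambda>s. f u s - f v s)) \<le> (1/2) * dist u v * exp (\<kappa> * r)" .
    have "integral {0..r} (f u) - integral {0..r} (f v) = integral {0..r} (\<lambda>s. f u s - f v s)"
      by (rule integral_diff[symmetric]) (intro integrable_continuous_real f_cont)+
    then have "G u r - G v r = exp (- \<kappa> * r) *\<^sub>R integral {0..r} (\<lambda>s. f u s - f v s)"
      by (simp add: G_def flip: scaleR_diff_right)
    then have "dist (G u r) (G v r) = exp (- \<kappa> * r) * norm (integral {0..r} (\<lambda>s. f u s - f v s))"
      by (simp add: dist_norm)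
    also have "\<dots> \<le> exp (- \<kappa> * r) * ((1/2) * dist u v * exp (\<kappa> * r))"
      by (intro mult_left_mono le) auto
    also have "\<dots> = (1/2) * dist u v"
      by (simp add: exp_minus field_simps)
    finally show "dist (apply_bcontfun (\<Phi> u) t) (apply_bcontfun (\<Phi> v) t) \<le> (1/2) * dist u v"
      by (simp add: \<Phi> r_def)
  qed
  have "\<exists>!u. \<Phi> u = u"
    using banach_fix_type[of "1/2" \<Phi>] contr by auto
  then obtain u where u: "\<Phi> u = u" by blast
  define y where "y t = exp (\<kappa> * t) *\<^sub>R apply_bcontfun u t" for t
  have y_eq: "y t = z + integral {0..t} (\<lambda>s. h (y s))" if "t \<in> {0..S}" for t
  proof -
    have "apply_bcontfun u t = G u t" using \<Phi>[of u t] u cl_id[OF that] by simp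
    then show ?thesis by (simp add: y_def G_def f_def[abs_def] exp_minus)
  qed
  have "(y has_vector_derivative h (y t)) (at t within {0..S})" if t: "t \<in> {0..S}" for t
  proof (rule has_vector_derivative_transform[OF t])
    have "continuous_on {0..S} (\<lambda>s. h (y s))"
      unfolding y_def by (intro continuous_on_compose2[OF h_cont[of UNIV]] continuous_intros) auto
    from integral_has_vector_derivative[OF this t]
    show "((\<lambda>t. z + integral {0..t} (\<lambda>s. h (y s))) has_vector_derivative h (y t)) (at t within {0..S})"
      by (auto intro!: derivative_eq_intros)
  qed (use y_eq in auto)
  moreover have "y 0 = z" using y_eq[of 0] \<open>0 \<le> S\<close> by simp
  ultimately show ?thesis unfolding solves_ode_on_def by blast
qed

lemma solves_ode_on_subset:
  "solves_ode_on h y A \<Longrightarrow> A' \<subseteq> A \<Longrightarrow> solves_ode_on h y A'"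
  unfolding solves_ode_on_def by (meson has_vector_derivative_within_subset subsetD)

lemma solves_ode_on_continuous: "solves_ode_on h y A \<Longrightarrow> continuous_on A y"
  unfolding solves_ode_on_def
  by (meson continuous_on_eq_continuous_within has_vector_derivative_continuous)

lemma solves_ode_on_interior:
  assumes "solves_ode_on h y {a..b}" "a < t" "t < b"
  shows "(y has_vector_derivative h (y t)) (at t)"
  using assms at_within_Icc_at[of a t b] unfolding solves_ode_on_def
  by (metis atLeastAtMost_iff less_imp_le)

text \<open>
  The equation is autonomous: every block, wherever it sits on the time axis, is compared with a
  solution started at time 0.
\<close>
lemma solves_ode_on_shift:
  assumes "solves_ode_on h y {0..b - s}"
  shows "solves_ode_on h (\<lambda>t. y (t - s)) {s..b}"
  unfolding solves_ode_on_def
proof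
  fix t assume t: "t \<in> {s..b}"
  have "(y has_vector_derivative h (y (t - s))) (at (t - s) within (\<lambda>t. t - s) ` {s..b})"
    using assms t unfolding solves_ode_on_def
    by (auto intro!: has_vector_derivative_within_subset[of _ _ _ "{0..b - s}"])
  moreover have "((\<lambda>t. t - s) has_vector_derivative 1) (at t within {s..b})"
    by (auto intro!: derivative_eq_intros)
  ultimately have "(y \<circ> (\<lambda>t. t - s) has_vector_derivative 1 *\<^sub>R h (y (t - s))) (at t within {s..b})"
    by (intro vector_diff_chain_within) auto
  then show "((\<lambda>t. y (t - s)) has_vector_derivative h (y (t - s))) (at t within {s..b})"
    by (simp add: o_def)
qed

text \<open>
  By the Lipschitz bound, \<open>exp (- 2 L t) \<parallel>y t - w t\<parallel>\<^sup>2\<close> has nonpositive derivative, and it starts at 0.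
\<close>
lemma solves_ode_on_unique:
  fixes h :: "'v::real_inner \<Rightarrow> 'v"
  assumes lip: "L-lipschitz_on UNIV h"
    and y: "solves_ode_on h y {a..b}" and w: "solves_ode_on h w {a..b}"
    and "a \<le> b" "y a = w a"
  shows "y b = w b"
proof -
  define g where "g t = exp (- 2 * L * t) * ((y t - w t) \<bullet> (y t - w t))" for t
  have "g b \<le> g a"
  proof (rule DERIV_nonpos_imp_decreasing_open[OF \<open>a \<le> b\<close>])
    fix t assume t: "a < t" "t < b"
    let ?d = "y t - w t"
    have dy: "(y has_derivative (\<lambda>s. s *\<^sub>R h (y t))) (at t)"
      using solves_ode_on_interior[OF y t] by (simp add: has_vector_derivative_def)
    have dw: "(w has_derivative (\<lambda>s. s *\<^sub>R h (w t))) (at t)"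
      using solves_ode_on_interior[OF w t] by (simp add: has_vector_derivative_def)
    have "DERIV g t :> 2 * exp (- 2 * L * t) * (?d \<bullet> (h (y t) - h (w t)) - L * (?d \<bullet> ?d))"
      unfolding g_def has_field_derivative_def
      by (rule has_derivative_eq_rhs, (rule derivative_eq_intros dy dw refl | simp)+)
         (simp add: fun_eq_iff algebra_simps inner_commute inner_diff_left inner_diff_right)
    moreover have "?d \<bullet> (h (y t) - h (w t)) \<le> L * (?d \<bullet> ?d)"
    proof -
      have "?d \<bullet> (h (y t) - h (w t)) \<le> norm ?d * norm (h (y t) - h (w t))"
        by (rule norm_cauchy_schwarz)
      also have "\<dots> \<le> norm ?d * (L * norm ?d)"
        using lipschitz_onD[OF lip, of "y t" "w t"] by (intro mult_left_mono) (auto simp: dist_norm)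
      also have "\<dots> = L * (?d \<bullet> ?d)" by (simp add: dot_square_norm power2_eq_square)
      finally show ?thesis .
    qed
    ultimately show "\<exists>l. DERIV g t :> l \<and> l \<le> 0"
      by (intro exI conjI) (assumption, simp add: mult_le_0_iff)
  next
    show "continuous_on {a..b} g"
      unfolding g_def by (intro continuous_intros solves_ode_on_continuous[OF y] solves_ode_on_continuous[OF w])
  qed
  also have "g a = 0" using \<open>y a = w a\<close> by (simp add: g_def)
  finally have "(y b - w b) \<bullet> (y b - w b) \<le> 0" by (simp add: g_def mult_le_0_iff)
  then show ?thesis by (metis inner_ge_zero inner_eq_zero_iff order_antisym right_minus_eq)
qed

lemma ode_value_eq:
  fixes h :: "'v::real_inner \<Rightarrow> 'v"
  assumes lip: "L-lipschitz_on UNIV h"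
    and y: "solves_ode_on h y {0..S}" and t: "s \<le> t" "t \<le> s + S"
  shows "ode_value h s (y 0) t = y (t - s)"
  unfolding ode_value_def
proof (rule the_equality)
  have sol: "solves_ode_on h (\<lambda>t. y (t - s)) {s..t}"
    using t by (intro solves_ode_on_shift solves_ode_on_subset[OF y]) auto
  then show "\<exists>v. solves_ode_on h v {s..t} \<and> v s = y 0 \<and> v t = y (t - s)"
    by (intro exI[of _ "\<lambda>t. y (t - s)"]) simp
  fix w assume "\<exists>v. solves_ode_on h v {s..t} \<and> v s = y 0 \<and> v t = w"
  then show "w = y (t - s)"
    using solves_ode_on_unique[OF lip _ sol t(1)] by force
qed

text \<open>
  The derivative of \<open>V\<close> along a solution is \<open>gradV \<bullet> h\<close>.
\<close>
lemma lyapunov_nonincreasing: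
  fixes V :: "'v::real_inner \<Rightarrow> real"
  assumes V_grad: "\<And>z. GDERIV V z :> gradV z"
    and V_descent: "\<And>z. gradV z \<bullet> h z \<le> 0"
    and y: "solves_ode_on h y {0..S}" and t: "0 \<le> t" "t \<le> S"
  shows "V (y t) \<le> V (y 0)"
proof (rule DERIV_nonpos_imp_decreasing_open[of 0 t "\<lambda>t. V (y t)", OF t(1)])
  fix s assume s: "0 < s" "s < t"
  have "(y has_derivative (\<lambda>r. r *\<^sub>R h (y s))) (at s)"
    using solves_ode_on_interior[OF y] s t by (simp add: has_vector_derivative_def)
  moreover have "(V has_derivative (\<lambda>v. v \<bullet> gradV (y s))) (at (y s))"
    using V_grad[of "y s"] by (simp add: gderiv_def inner_commute)
  ultimately have "((\<lambda>t. V (y t)) has_derivative (\<lambda>r. (r *\<^sub>R h (y s)) \<bullet> gradV (y s))) (at s)"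
    by (rule has_derivative_compose)
  then have "DERIV (\<lambda>t. V (y t)) s :> gradV (y s) \<bullet> h (y s)"
    unfolding has_field_derivative_def by (rule has_derivative_eq_rhs) (simp add: fun_eq_iff inner_commute)
  then show "\<exists>l. DERIV (\<lambda>t. V (y t)) s :> l \<and> l \<le> 0" using V_descent by blast
next
  have "isCont V z" for z
    using V_grad[of z] unfolding gderiv_def by (rule has_derivative_continuous)
  then have "continuous_on UNIV V" by (simp add: continuous_at_imp_continuous_on)
  then show "continuous_on {0..t} (\<lambda>t. V (y t))"
    by (rule continuous_on_compose2[OF _ solves_ode_on_continuous])
       (use t in \<open>auto intro: solves_ode_on_subset[OF y]\<close>)
qed

section \<open>Error of the Euler scheme\<close>

lemma discrete_gronwall:
  fixes e g :: "nat \<Rightarrow> real"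
  assumes "\<And>i. i \<le> j \<Longrightarrow> e i \<le> A + (\<Sum>k<i. g k * e k)"
    and g: "\<And>k. 0 \<le> g k" and "0 \<le> A" and "i \<le> j"
  shows "e i \<le> A * exp (\<Sum>k<i. g k)"
  using \<open>i \<le> j\<close>
proof (induction i rule: less_induct)
  case (less i)
  have sum_le: "A + (\<Sum>k<m. g k * (A * exp (\<Sum>l<k. g l))) \<le> A * exp (\<Sum>k<m. g k)" for m
  proof (induction m)
    case (Suc m)
    have "A + (\<Sum>k<Suc m. g k * (A * exp (\<Sum>l<k. g l)))
        \<le> (1 + g m) * (A * exp (\<Sum>k<m. g k))"
      using Suc by (simp add: algebra_simps)
    also have "\<dots> \<le> exp (g m) * (A * exp (\<Sum>k<m. g k))"
      using \<open>0 \<le> A\<close> exp_ge_add_one_self by (intro mult_right_mono) auto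
    finally show ?case by (simp add: exp_add algebra_simps)
  qed simp
  have "e i \<le> A + (\<Sum>k<i. g k * e k)" using assms(1) less.prems by blast
  also have "\<dots> \<le> A + (\<Sum>k<i. g k * (A * exp (\<Sum>l<k. g l)))"
    using less g by (intro add_left_mono sum_mono mult_left_mono) auto
  also have "\<dots> \<le> A * exp (\<Sum>k<i. g k)" by (rule sum_le)
  finally show ?case .
qed

lemma solves_ode_on_lipschitz:
  assumes y: "solves_ode_on h y {0..S}" and C: "\<And>t. t \<in> {0..S} \<Longrightarrow> norm (h (y t)) \<le> C"
    and "s \<in> {0..S}" "t \<in> {0..S}"
  shows "norm (y t - y s) \<le> C * \<bar>t - s\<bar>"
proof -
  have "norm (y t - y s) \<le> C * norm (t - s)"
  proof (rule differentiable_bound[of "{0..S}"])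
    show "(y has_derivative (\<lambda>r. r *\<^sub>R h (y u))) (at u within {0..S})" if "u \<in> {0..S}" for u
      using y that unfolding solves_ode_on_def has_vector_derivative_def by blast
    show "onorm (\<lambda>r. r *\<^sub>R h (y u)) \<le> C" if "u \<in> {0..S}" for u
      using C[OF that] by (intro onorm_le) (simp add: mult.commute[of C] mult_left_mono)
  qed (use assms in auto)
  then show ?thesis by simp
qed

lemma euler_step_error:
  assumes lip: "L-lipschitz_on UNIV h"
    and y: "solves_ode_on h y {0..S}" and C: "\<And>t. t \<in> {0..S} \<Longrightarrow> norm (h (y t)) \<le> C"
    and st: "0 \<le> s" "s \<le> t" "t \<le> S"
  shows "norm (y t - y s - (t - s) *\<^sub>R h (y s)) \<le> (t - s) * (L * C * (t - s))"
proof -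
  have L0: "0 \<le> L" using lip by (rule lipschitz_on_nonneg)
  have "norm (y t - y s - (t - s) *\<^sub>R h (y s)) \<le> norm (t - s) * (L * C * (t - s))"
  proof (rule vector_differentiable_bound_linearization[of "{s..t}" y "\<lambda>u. h (y u)" s t s])
    show "(y has_vector_derivative h (y u)) (at u within {s..t})" if "u \<in> {s..t}" for u
      using solves_ode_on_subset[OF y, of "{s..t}"] st that unfolding solves_ode_on_def by auto
    show "norm (h (y u) - h (y s)) \<le> L * C * (t - s)" if u: "u \<in> {s..t}" for u
    proof -
      have "norm (h (y u) - h (y s)) \<le> L * norm (y u - y s)"
        using lipschitz_onD[OF lip, of "y u" "y s"] by (simp add: dist_norm)
      also have "\<dots> \<le> L * (C * \<bar>u - s\<bar>)"
        using u st L0 by (intro mult_left_mono solves_ode_on_lipschitz[OF y C]) auto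
      also have "\<dots> \<le> L * (C * (t - s))"
        using u st L0 order_trans[OF norm_ge_zero C[of s]] by (intro mult_left_mono) auto
      finally show ?thesis by simp
    qed
  qed (use st in \<open>auto simp: closed_segment_eq_real_ivl\<close>)
  then show ?thesis using st by simp
qed

section \<open>Step sizes, interpolation and blocks\<close>

locale divergent_steps =
  fixes a :: "nat \<Rightarrow> real"
  assumes step_pos: "\<And>n. 0 < a n" and step_div: "\<not> summable a"
begin

lemma sa_time_0 [simp]: "sa_time a 0 = 0"
  by (simp add: sa_time_def)

lemma sa_time_Suc: "sa_time a (Suc n) = sa_time a n + a n"
  by (simp add: sa_time_def)

lemma sa_time_strict_mono: "strict_mono (sa_time a)"
  using step_pos by (intro strict_monoI_Suc) (simp add: sa_time_Suc)

lemma sa_time_less_iff [simp]: "sa_time a m < sa_time a n \<longleftrightarrow> m < n"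
  using sa_time_strict_mono by (rule strict_mono_less)

lemma sa_time_le_iff [simp]: "sa_time a m \<le> sa_time a n \<longleftrightarrow> m \<le> n"
  using sa_time_strict_mono by (rule strict_mono_less_eq)

lemma sa_time_nonneg: "0 \<le> sa_time a n"
  using sa_time_le_iff[of 0 n] by simp

lemma sa_time_add: "sa_time a (n + j) = sa_time a n + (\<Sum>k<j. a (n + k))"
  by (induction j) (simp_all add: sa_time_Suc)

lemma sa_time_unbounded: "\<exists>n. c \<le> sa_time a n"
proof (rule ccontr)
  assume "\<not> ?thesis"
  then have "\<And>n. (\<Sum>i<n. a i) \<le> c" by (auto simp: sa_time_def not_le intro: less_imp_le)
  then have "summable a"
    using step_pos by (intro summableI_nonneg_bounded[where x = c]) (auto intro: less_imp_le)
  then show False using step_div by blast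
qed

lemma sa_time_bracket:
  assumes "0 \<le> t"
  obtains n where "sa_time a n \<le> t" "t < sa_time a (Suc n)"
proof -
  obtain m where m: "t < sa_time a m"
    using sa_time_unbounded[of "t + 1"] by (meson less_add_one less_le_trans)
  define k where "k = (LEAST m. t < sa_time a m)"
  have k: "t < sa_time a k" unfolding k_def using m by (rule LeastI)
  then have "k \<noteq> 0" using assms by (metis leD sa_time_0)
  then obtain n where n: "k = Suc n" by (metis not0_implies_Suc)
  have "\<not> t < sa_time a n"
    using not_less_Least[of n "\<lambda>m. t < sa_time a m"] n unfolding k_def by simp
  then show ?thesis using that[of n] k n by simp
qed

lemma interpolate_eq:
  fixes z :: "nat \<Rightarrow> 'v::real_vector"
  assumes t: "sa_time a n \<le> t" "t \<le> sa_time a (Suc n)"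
  shows "interpolate a z t = z n + ((t - sa_time a n) / a n) *\<^sub>R (z (Suc n) - z n)"
proof (cases "t < sa_time a (Suc n)")
  case True
  have "(LEAST m. t < sa_time a (Suc m)) = n"
  proof (rule Least_equality)
    fix m assume "t < sa_time a (Suc m)"
    then have "sa_time a n < sa_time a (Suc m)" using t by linarith
    then show "n \<le> m" by simp
  qed (rule True)
  then show ?thesis by (simp add: interpolate_def)
next
  case False
  then have eq: "t = sa_time a (Suc n)" using t by simp
  have "(LEAST m. t < sa_time a (Suc m)) = Suc n"
    by (rule Least_equality) (auto simp: eq)
  then have "interpolate a z t = z (Suc n)" by (simp add: interpolate_def eq)
  moreover have "(t - sa_time a n) / a n = 1"
    using step_pos[of n] by (simp add: eq sa_time_Suc)
  ultimately show ?thesis by simp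
qed

text \<open>
  A block lasts at least \<open>T\<close> because it ends at the first grid time at or past that mark, and it overshoots
  the mark by less than its last step.
\<close>
lemma block_start_step:
  fixes i n0 :: nat
  assumes "0 < T"
  defines "n \<equiv> block_start a T n0 i" and "n' \<equiv> block_start a T n0 (Suc i)"
  shows "sa_time a n + T \<le> sa_time a n'" "n < n'"
    "sa_time a n' < sa_time a n + T + a (n' - 1)"
proof -
  have n': "n' = (LEAST m. sa_time a m \<ge> sa_time a n + T)" by (simp add: n'_def n_def)
  show *: "sa_time a n + T \<le> sa_time a n'"
    using sa_time_unbounded unfolding n' by (rule LeastI_ex)
  then have "sa_time a n < sa_time a n'" using \<open>0 < T\<close> by linarith
  then show lt: "n < n'" by simp
  have "\<not> sa_time a (n' - 1) \<ge> sa_time a n + T"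
    using lt unfolding n' by (intro not_less_Least) auto
  moreover have "sa_time a n' = sa_time a (n' - 1) + a (n' - 1)"
    using lt sa_time_Suc[of "n' - 1"] by simp
  ultimately show "sa_time a n' < sa_time a n + T + a (n' - 1)" by linarith
qed

lemma block_start_strict_mono: "0 < T \<Longrightarrow> strict_mono (block_start a T n0)"
  by (rule strict_monoI_Suc) (rule block_start_step)

lemma block_start_ge: "0 < T \<Longrightarrow> n0 + i \<le> block_start a T n0 i"
proof (induction i)
  case (Suc i)
  then show ?case using block_start_step(2)[of T n0 i] by simp
qed simp

section \<open>Tracking of a solution by a noisy Euler scheme\<close>

context
  fixes h :: "'v::real_inner \<Rightarrow> 'v" and y :: "real \<Rightarrow> 'v" and z \<nu> :: "nat \<Rightarrow> 'v"
    and L S C \<alpha> \<eta> :: real and n j :: nat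
  assumes lip: "L-lipschitz_on UNIV h"
    and y: "solves_ode_on h y {0..S}" "y 0 = z n"
    and C: "\<And>t. t \<in> {0..S} \<Longrightarrow> norm (h (y t)) \<le> C"
    and rec: "\<And>m. z (Suc m) = z m + a m *\<^sub>R (h (z m) + \<nu> (Suc m))"
    and \<alpha>: "\<And>m. n \<le> m \<Longrightarrow> a m \<le> \<alpha>"
    and len: "sa_time a (n + j) \<le> sa_time a n + S"
    and noise: "\<And>i. i \<le> j \<Longrightarrow> norm (\<Sum>k<i. a (n + k) *\<^sub>R \<nu> (n + k + 1)) \<le> \<eta>"
begin

text \<open>
  The recursion is an Euler scheme for the differential equation, perturbed by the noise. Summing the
  steps, the noise enters only through its partial sums, of size \<open>\<eta>\<close>, and each Euler step costs
  \<open>L C a\<^sup>2 \<le> L C \<alpha> a\<close>, hence \<open>L C S \<alpha>\<close> in total; Gronwall then contributes the factor \<open>exp (L S)\<close>.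
\<close>
lemma grid_tracking:
  assumes "i \<le> j"
  shows "norm (z (n + i) - y (sa_time a (n + i) - sa_time a n)) \<le> (\<eta> + L * C * S * \<alpha>) * exp (L * S)"
proof -
  define \<tau> where "\<tau> i = sa_time a (n + i) - sa_time a n" for i
  have \<tau>_Suc: "\<tau> (Suc i) = \<tau> i + a (n + i)" for i by (simp add: \<tau>_def sa_time_Suc)
  have \<tau>_sum: "\<tau> i = (\<Sum>k<i. a (n + k))" for i by (simp add: \<tau>_def sa_time_add)
  have \<tau>_range: "\<tau> i \<in> {0..S}" if "i \<le> j" for i
    using len that sa_time_le_iff[of "n + i" "n + j"] sa_time_le_iff[of n "n + i"]
    by (simp add: \<tau>_def del: sa_time_le_iff)
  have S0: "0 \<le> S" and L0: "0 \<le> L" and \<eta>0: "0 \<le> \<eta>"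
    using \<tau>_range[of 0] lipschitz_on_nonneg[OF lip] noise[of 0] by auto
  have C0: "0 \<le> C" using S0 C[of 0] by (auto intro: order_trans[OF norm_ge_zero])
  have \<alpha>0: "0 \<le> \<alpha>" using step_pos[of n] \<alpha>[of n] by simp
  define r where "r k = y (\<tau> (Suc k)) - y (\<tau> k) - a (n + k) *\<^sub>R h (y (\<tau> k))" for k
  have r: "norm (r k) \<le> a (n + k) * (L * C * \<alpha>)" if "k < j" for k
  proof -
    have "norm (r k) \<le> a (n + k) * (L * C * a (n + k))"
      using euler_step_error[OF lip y(1) C, of "\<tau> k" "\<tau> (Suc k)"] \<tau>_range[of k] \<tau>_range[of "Suc k"] that
        step_pos[of "n + k"] by (simp add: r_def \<tau>_Suc)
    also have "\<dots> \<le> a (n + k) * (L * C * \<alpha>)"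
      using \<alpha>[of "n + k"] L0 C0 step_pos[of "n + k"] by (intro mult_left_mono) auto
    finally show ?thesis .
  qed
  define e where "e i = norm (z (n + i) - y (\<tau> i))" for i
  have decomp: "z (n + i) - y (\<tau> i) =
      (\<Sum>k<i. a (n + k) *\<^sub>R (h (z (n + k)) - h (y (\<tau> k))))
      + (\<Sum>k<i. a (n + k) *\<^sub>R \<nu> (n + k + 1)) - (\<Sum>k<i. r k)" for i
  proof (induction i)
    case 0
    then show ?case using y(2) by (simp add: \<tau>_def)
  next
    case (Suc i)
    have "z (n + Suc i) - y (\<tau> (Suc i)) = (z (n + i) - y (\<tau> i))
        + a (n + i) *\<^sub>R (h (z (n + i)) - h (y (\<tau> i))) + a (n + i) *\<^sub>R \<nu> (n + i + 1) - r i"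
      using rec[of "n + i"] by (simp add: r_def algebra_simps)
    then show ?case using Suc by simp
  qed
  have "e i \<le> (\<eta> + L * C * S * \<alpha>) + (\<Sum>k<i. (L * a (n + k)) * e k)" if i: "i \<le> j" for i
  proof -
    have "norm (\<Sum>k<i. a (n + k) *\<^sub>R (h (z (n + k)) - h (y (\<tau> k)))) \<le> (\<Sum>k<i. (L * a (n + k)) * e k)"
    proof (rule sum_norm_le)
      fix k
      have "norm (h (z (n + k)) - h (y (\<tau> k))) \<le> L * e k"
        using lipschitz_onD[OF lip, of "z (n + k)" "y (\<tau> k)"] by (simp add: dist_norm e_def)
      then have "a (n + k) * norm (h (z (n + k)) - h (y (\<tau> k))) \<le> a (n + k) * (L * e k)"
        using step_pos[of "n + k"] by (intro mult_left_mono) auto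
      then show "norm (a (n + k) *\<^sub>R (h (z (n + k)) - h (y (\<tau> k)))) \<le> (L * a (n + k)) * e k"
        using step_pos[of "n + k"] by (simp add: mult_ac)
    qed
    moreover have "norm (\<Sum>k<i. r k) \<le> L * C * S * \<alpha>"
    proof -
      have "norm (\<Sum>k<i. r k) \<le> (\<Sum>k<i. a (n + k) * (L * C * \<alpha>))"
        using r i by (intro sum_norm_le) auto
      also have "\<dots> = \<tau> i * (L * C * \<alpha>)" by (simp add: \<tau>_sum sum_distrib_right)
      also have "\<dots> \<le> S * (L * C * \<alpha>)"
        using \<tau>_range[OF i] L0 C0 \<alpha>0 by (intro mult_right_mono) auto
      finally show ?thesis by (simp add: mult_ac)
    qed
    moreover have "e i \<le> norm (\<Sum>k<i. a (n + k) *\<^sub>R (h (z (n + k)) - h (y (\<tau> k))))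
        + norm (\<Sum>k<i. a (n + k) *\<^sub>R \<nu> (n + k + 1)) + norm (\<Sum>k<i. r k)"
      unfolding e_def decomp
      by (rule order_trans[OF norm_triangle_ineq4]) (intro add_right_mono norm_triangle_ineq)
    ultimately show ?thesis using noise[OF i] by linarith
  qed
  then have "e i \<le> (\<eta> + L * C * S * \<alpha>) * exp (\<Sum>k<i. L * a (n + k))"
    using \<open>i \<le> j\<close> \<eta>0 L0 C0 S0 \<alpha>0 step_pos
    by (intro discrete_gronwall[of j]) (auto simp: less_imp_le)
  also have "(\<Sum>k<i. L * a (n + k)) = L * \<tau> i" by (simp add: \<tau>_sum sum_distrib_left)
  also have "(\<eta> + L * C * S * \<alpha>) * exp (L * \<tau> i) \<le> (\<eta> + L * C * S * \<alpha>) * exp (L * S)"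
    using \<tau>_range[OF \<open>i \<le> j\<close>] \<eta>0 L0 C0 S0 \<alpha>0 by (intro mult_left_mono) (auto simp: mult_left_mono)
  finally show ?thesis by (simp add: e_def \<tau>_def)
qed

text \<open>
  Between grid points the interpolated path is a convex combination of two iterates, both close to the
  solution at the intermediate time, since the solution moves by at most \<open>C \<alpha>\<close> during one step.
\<close>
lemma interpolated_tracking:
  assumes t: "sa_time a n \<le> t" "t \<le> sa_time a (n + j)" and "0 < j"
  shows "norm (interpolate a z t - y (t - sa_time a n)) \<le> (\<eta> + L * C * S * \<alpha>) * exp (L * S) + C * \<alpha>"
proof -
  define E where "E = (\<eta> + L * C * S * \<alpha>) * exp (L * S)"
  have "\<exists>i<j. sa_time a (n + i) \<le> t \<and> t \<le> sa_time a (n + Suc i)"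
  proof -
    obtain m where m: "sa_time a m \<le> t" "t < sa_time a (Suc m)"
      using sa_time_bracket t(1) sa_time_nonneg by (metis order_trans)
    have "sa_time a n < sa_time a (Suc m)" "sa_time a m \<le> sa_time a (n + j)"
      using m t by linarith+
    then have nm: "n \<le> m" "m \<le> n + j" by simp_all
    show ?thesis
    proof (cases "m = n + j")
      case True
      then have "t = sa_time a (n + j)" using m t by simp
      then show ?thesis using \<open>0 < j\<close> by (intro exI[of _ "j - 1"]) auto
    next
      case False
      then show ?thesis using nm m by (intro exI[of _ "m - n"]) auto
    qed
  qed
  then obtain i where i: "i < j" "sa_time a (n + i) \<le> t" "t \<le> sa_time a (n + Suc i)" by blast
  define \<tau> where "\<tau> = t - sa_time a n"
  define \<tau>' where "\<tau>' k = sa_time a (n + k) - sa_time a n" for k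
  have \<tau>'_range: "\<tau>' k \<in> {0..S}" if "k \<le> j" for k
    using len that sa_time_le_iff[of "n + k" "n + j"] sa_time_le_iff[of n "n + k"]
    by (simp add: \<tau>'_def del: sa_time_le_iff)
  have \<tau>_range: "\<tau> \<in> {0..S}" using t len by (simp add: \<tau>_def)
  have C0: "0 \<le> C" using C[OF \<tau>_range] by (rule order_trans[OF norm_ge_zero])
  have near: "norm (z (n + k) - y \<tau>) \<le> E + C * \<alpha>" if k: "k = i \<or> k = Suc i" for k
  proof -
    have "\<bar>\<tau> - \<tau>' k\<bar> \<le> a (n + i)"
      using k i by (auto simp: \<tau>_def \<tau>'_def sa_time_Suc)
    then have "\<bar>\<tau> - \<tau>' k\<bar> \<le> \<alpha>" using \<alpha>[of "n + i"] by simp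
    have "k \<le> j" using k i by auto
    have "norm (y \<tau> - y (\<tau>' k)) \<le> C * \<bar>\<tau> - \<tau>' k\<bar>"
      using solves_ode_on_lipschitz[OF y(1) C \<tau>'_range[OF \<open>k \<le> j\<close>] \<tau>_range] .
    also have "\<dots> \<le> C * \<alpha>" using \<open>\<bar>\<tau> - \<tau>' k\<bar> \<le> \<alpha>\<close> C0 by (rule mult_left_mono)
    finally have "norm (y \<tau> - y (\<tau>' k)) \<le> C * \<alpha>" .
    moreover have "norm (z (n + k) - y (\<tau>' k)) \<le> E"
      using grid_tracking[OF \<open>k \<le> j\<close>] by (simp add: E_def \<tau>'_def)
    ultimately show ?thesis
      using norm_triangle_ineq4[of "z (n + k) - y (\<tau>' k)" "y \<tau> - y (\<tau>' k)"] by simp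
  qed
  define \<theta> where "\<theta> = (t - sa_time a (n + i)) / a (n + i)"
  have \<theta>: "0 \<le> \<theta>" "\<theta> \<le> 1"
    using i step_pos[of "n + i"] by (auto simp: \<theta>_def sa_time_Suc field_simps)
  have "interpolate a z t = z (n + i) + \<theta> *\<^sub>R (z (n + Suc i) - z (n + i))"
    using interpolate_eq[of "n + i" t z] i by (simp add: \<theta>_def)
  then have "interpolate a z t - y \<tau> = (1 - \<theta>) *\<^sub>R (z (n + i) - y \<tau>) + \<theta> *\<^sub>R (z (n + Suc i) - y \<tau>)"
    by (simp add: algebra_simps)
  then have "norm (interpolate a z t - y \<tau>) \<le> (1 - \<theta>) * norm (z (n + i) - y \<tau>) + \<theta> * norm (z (n + Suc i) - y \<tau>)"
    using \<theta> norm_triangle_ineq[of "(1 - \<theta>) *\<^sub>R (z (n + i) - y \<tau>)" "\<theta> *\<^sub>R (z (n + Suc i) - y \<tau>)"] by simp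
  also have "\<dots> \<le> E + C * \<alpha>"
    using \<theta> near[of i] near[of "Suc i"] by (intro convex_bound_le) auto
  finally show ?thesis by (simp add: E_def \<tau>_def)
qed

end

end

section \<open>Exponential moments of the noise\<close>

text \<open>
  A weighted tail of order \<open>exp (- c v)\<close> gives an exponential moment at half the rate: cutting the range
  of \<open>\<xi>\<close> at the integers, the layer \<open>k < \<xi> \<le> k + 1\<close> contributes a term of order
  \<open>exp (c k / 2) exp (- c k)\<close>, and these form a geometric series. The weight \<open>Z\<close> plays the part of an
  arbitrary past-measurable factor, so the estimate is a conditional one in integrated form.
\<close>
lemma (in prob_space) exp_moment_of_tail:
  fixes Z \<xi> :: "'a \<Rightarrow> real" and k0 :: nat
  assumes Z: "integrable M Z" "\<And>\<omega>. 0 \<le> Z \<omega>"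
    and \<xi> [measurable]: "\<xi> \<in> borel_measurable M"
    and c: "0 < c" and C1: "0 < C1"
    and tail: "\<And>k. k0 \<le> k \<Longrightarrow>
      (\<integral>\<omega>. Z \<omega> * indicator {\<omega> \<in> space M. real k < \<xi> \<omega>} \<omega> \<partial>M) \<le> C1 * exp (- c * k) * (\<integral>\<omega>. Z \<omega> \<partial>M)"
  defines "K \<equiv> exp (c / 2 * k0) + C1 * exp (c / 2) / (1 - exp (- c / 2))"
  shows "integrable M (\<lambda>\<omega>. Z \<omega> * exp (c / 2 * \<xi> \<omega>))"
    and "(\<integral>\<omega>. Z \<omega> * exp (c / 2 * \<xi> \<omega>) \<partial>M) \<le> K * (\<integral>\<omega>. Z \<omega> \<partial>M)"
proof -
  define D where "D = (\<integral>\<omega>. Z \<omega> \<partial>M)"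
  have D: "0 \<le> D" using Z by (simp add: D_def)
  have Zm [measurable]: "Z \<in> borel_measurable M" using Z by auto
  define E where "E k = {\<omega> \<in> space M. real (k0 + k) < \<xi> \<omega>}" for k
  have [measurable]: "E k \<in> sets M" for k unfolding E_def by measurable
  define w where "w k = exp (c / 2 * (k0 + k + 1))" for k :: nat
  have pt: "ennreal (Z \<omega> * exp (c / 2 * \<xi> \<omega>)) \<le>
      ennreal (exp (c / 2 * k0)) * ennreal (Z \<omega>) + (\<Sum>k. ennreal (w k) * ennreal (Z \<omega> * indicator (E k) \<omega>))"
    if \<omega>: "\<omega> \<in> space M" for \<omega>
  proof (cases "\<xi> \<omega> \<le> k0")
    case True
    then have "Z \<omega> * exp (c / 2 * \<xi> \<omega>) \<le> exp (c / 2 * k0) * Z \<omega>"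
      using Z(2)[of \<omega>] c by (subst mult.commute) (intro mult_right_mono, auto)
    then have "ennreal (Z \<omega> * exp (c / 2 * \<xi> \<omega>)) \<le> ennreal (exp (c / 2 * k0)) * ennreal (Z \<omega>)"
      using Z(2) by (simp add: ennreal_mult[symmetric] ennreal_leI)
    then show ?thesis by (rule order_trans) simp
  next
    case False
    define k where "k = nat \<lceil>\<xi> \<omega>\<rceil> - 1 - k0"
    have "real k0 < \<xi> \<omega>" using False by simp
    then have gt: "int k0 < \<lceil>\<xi> \<omega>\<rceil>" by (simp add: less_ceiling_iff)
    then have "\<lceil>\<xi> \<omega>\<rceil> = int (k0 + k) + 1" unfolding k_def by linarith
    then have k: "real (k0 + k) < \<xi> \<omega>" "\<xi> \<omega> \<le> real (k0 + k + 1)"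
      by linarith+
    have "Z \<omega> * exp (c / 2 * \<xi> \<omega>) \<le> w k * (Z \<omega> * indicator (E k) \<omega>)"
      using k \<omega> Z(2)[of \<omega>] c unfolding w_def E_def by (simp add: mult.commute[of _ "Z \<omega>"] mult_left_mono)
    then have "ennreal (Z \<omega> * exp (c / 2 * \<xi> \<omega>)) \<le> ennreal (w k) * ennreal (Z \<omega> * indicator (E k) \<omega>)"
      using Z(2)[of \<omega>] by (simp add: w_def ennreal_mult[symmetric] ennreal_leI)
    also have "\<dots> \<le> (\<Sum>k. ennreal (w k) * ennreal (Z \<omega> * indicator (E k) \<omega>))"
      using sum_le_suminf[of "\<lambda>k. ennreal (w k) * ennreal (Z \<omega> * indicator (E k) \<omega>)" "{k}"]
      by (simp add: summableI)
    finally show ?thesis by (rule order_trans) simp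
  qed
  have intE: "integrable M (\<lambda>\<omega>. Z \<omega> * indicator (E k) \<omega>)" for k
    using Z(1) by (intro integrable_real_mult_indicator) auto
  have nnE: "(\<integral>\<^sup>+\<omega>. ennreal (Z \<omega> * indicator (E k) \<omega>) \<partial>M) \<le> ennreal (C1 * exp (- c * (k0 + k)) * D)" for k
  proof -
    have "(\<integral>\<^sup>+\<omega>. ennreal (Z \<omega> * indicator (E k) \<omega>) \<partial>M) = ennreal (\<integral>\<omega>. Z \<omega> * indicator (E k) \<omega> \<partial>M)"
      using intE Z(2) by (intro nn_integral_eq_integral) auto
    also have "\<dots> \<le> ennreal (C1 * exp (- c * (k0 + k)) * D)"
      using tail[of "k0 + k"] unfolding E_def D_def by (intro ennreal_leI) auto
    finally show ?thesis .
  qed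
  have summand_le: "w k * (C1 * exp (- c * (k0 + k)) * D) \<le> C1 * exp (c / 2) * D * exp (- c / 2) ^ k" for k
  proof -
    have pow: "exp (- c / 2) ^ k = exp (- c / 2 * k)"
      by (simp add: exp_of_nat_mult[symmetric] mult.commute)
    have w: "w k * exp (- c * (k0 + k)) = exp (c / 2) * exp (- c / 2 * (k0 + k))"
      unfolding w_def exp_add[symmetric] by (simp add: field_simps)
    have "w k * (C1 * exp (- c * (k0 + k)) * D) = C1 * D * (w k * exp (- c * (k0 + k)))" by simp
    also have "\<dots> = C1 * D * (exp (c / 2) * exp (- c / 2 * (k0 + k)))" by (simp only: w)
    also have "\<dots> \<le> C1 * D * (exp (c / 2) * exp (- c / 2 * k))"
      using C1 D c by (intro mult_left_mono) auto
    finally show ?thesis unfolding pow by (simp only: mult_ac)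
  qed
  have q: "exp (- c / 2) < 1" using c by simp
  have "(\<integral>\<^sup>+\<omega>. ennreal (Z \<omega> * exp (c / 2 * \<xi> \<omega>)) \<partial>M)
     \<le> (\<integral>\<^sup>+\<omega>. ennreal (exp (c / 2 * k0)) * ennreal (Z \<omega>)
          + (\<Sum>k. ennreal (w k) * ennreal (Z \<omega> * indicator (E k) \<omega>)) \<partial>M)"
    by (intro nn_integral_mono pt)
  also have "\<dots> = ennreal (exp (c / 2 * k0)) * (\<integral>\<^sup>+\<omega>. ennreal (Z \<omega>) \<partial>M)
      + (\<Sum>k. ennreal (w k) * (\<integral>\<^sup>+\<omega>. ennreal (Z \<omega> * indicator (E k) \<omega>) \<partial>M))"
    by (simp add: nn_integral_add nn_integral_suminf nn_integral_cmult)
  also have "\<dots> \<le> ennreal (exp (c / 2 * k0)) * ennreal D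
      + (\<Sum>k. ennreal (C1 * exp (c / 2) * D * exp (- c / 2) ^ k))"
  proof (intro add_mono suminf_le summableI mult_left_mono)
    show "(\<integral>\<^sup>+\<omega>. ennreal (Z \<omega>) \<partial>M) \<le> ennreal D"
      unfolding D_def using Z by (subst nn_integral_eq_integral) auto
    fix k
    have "ennreal (w k) * (\<integral>\<^sup>+\<omega>. ennreal (Z \<omega> * indicator (E k) \<omega>) \<partial>M)
        \<le> ennreal (w k) * ennreal (C1 * exp (- c * (k0 + k)) * D)"
      by (intro mult_left_mono nnE) auto
    also have "\<dots> = ennreal (w k * (C1 * exp (- c * (k0 + k)) * D))"
      using C1 D by (intro ennreal_mult[symmetric]) (auto simp: w_def)
    also have "\<dots> \<le> ennreal (C1 * exp (c / 2) * D * exp (- c / 2) ^ k)"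
      by (intro ennreal_leI summand_le)
    finally show "ennreal (w k) * (\<integral>\<^sup>+\<omega>. ennreal (Z \<omega> * indicator (E k) \<omega>) \<partial>M)
        \<le> ennreal (C1 * exp (c / 2) * D * exp (- c / 2) ^ k)" .
  qed auto
  also have "(\<Sum>k. ennreal (C1 * exp (c / 2) * D * exp (- c / 2) ^ k))
      = ennreal (C1 * exp (c / 2) * D * (1 / (1 - exp (- c / 2))))"
    using C1 D q by (intro suminf_ennreal_eq sums_mult geometric_sums) auto
  also have "ennreal (exp (c / 2 * k0)) * ennreal D + \<dots> = ennreal (K * D)"
    using C1 D q by (simp add: K_def ennreal_mult[symmetric] ennreal_plus[symmetric] algebra_simps del: ennreal_plus)
  finally have fin: "(\<integral>\<^sup>+\<omega>. ennreal (Z \<omega> * exp (c / 2 * \<xi> \<omega>)) \<partial>M) \<le> ennreal (K * D)" .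
  show int: "integrable M (\<lambda>\<omega>. Z \<omega> * exp (c / 2 * \<xi> \<omega>))"
    using fin Z(2) by (intro integrableI_nonneg) (auto intro: le_less_trans)
  have "0 \<le> K" using C1 q by (simp add: K_def)
  then show "(\<integral>\<omega>. Z \<omega> * exp (c / 2 * \<xi> \<omega>) \<partial>M) \<le> K * (\<integral>\<omega>. Z \<omega> \<partial>M)"
    using fin nn_integral_eq_integral[OF int] Z(2) D by (simp add: D_def[symmetric])
qed

lemma exp_le_quadratic_remainder:
  fixes s :: real
  shows "exp s \<le> 1 + s + s\<^sup>2 * exp \<bar>s\<bar>"
proof -
  obtain t where t: "\<bar>t\<bar> \<le> \<bar>s\<bar>" "exp s = (\<Sum>m<2. s ^ m / fact m) + exp t / fact 2 * s ^ 2"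
    using Maclaurin_exp_le[of s 2] by blast
  have "exp t / 2 * s\<^sup>2 \<le> exp \<bar>s\<bar> * s\<^sup>2"
  proof (rule mult_right_mono)
    have "exp t \<le> exp \<bar>s\<bar>" using t(1) by simp
    then show "exp t / 2 \<le> exp \<bar>s\<bar>" using exp_ge_zero[of t] by linarith
  qed simp
  then show ?thesis using t(2) by (simp add: numeral_2_eq_2 mult.commute)
qed

lemma square_le_exp:
  fixes s :: real
  assumes "0 \<le> s" shows "s\<^sup>2 \<le> 2 * exp s"
  using exp_lower_Taylor_quadratic[OF assms] assms by linarith


lemma borel_measurable_component [measurable (raw)]:
  fixes f :: "'w \<Rightarrow> real ^ 'n"
  assumes "f \<in> borel_measurable N"
  shows "(\<lambda>\<omega>. f \<omega> $ l) \<in> borel_measurable N"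
  using borel_measurable_continuous_onI[OF linear_continuous_on[OF bounded_linear_vec_nth]]
  by (rule measurable_compose[OF assms])

locale noisy_recursion = prob_space P + divergent_steps a
  for P :: "'w measure" and a :: "nat \<Rightarrow> real" +
  fixes h :: "real ^ 'd \<Rightarrow> real ^ 'd" and x M :: "nat \<Rightarrow> 'w \<Rightarrow> real ^ 'd" and C1 C2 :: real
  assumes h_cont: "continuous_on UNIV h"
    and x0_meas [measurable]: "x 0 \<in> borel_measurable P"
    and M_meas: "\<And>n. 1 \<le> n \<Longrightarrow> M n \<in> borel_measurable P"
    and iterates: "\<And>n \<omega>. \<omega> \<in> space P \<Longrightarrow> x (Suc n) \<omega> = x n \<omega> + a n *\<^sub>R (h (x n \<omega>) + M (Suc n) \<omega>)"
    and M_mds: "\<And>n k. AE \<omega> in P. real_cond_exp P (noise_filtration P x M n) (\<lambda>\<omega>. M (Suc n) \<omega> $ k) \<omega> = 0"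
    and C_pos: "0 < C1" "0 < C2"
    and M_tail: "\<exists>v0. \<forall>v\<ge>v0. \<forall>i. AE \<omega> in P.
             real_cond_exp P (noise_filtration P x M i)
               (indicator {\<omega> \<in> space P. norm (M (Suc i) \<omega>) / (1 + norm (x i \<omega>)) > v}) \<omega>
               \<le> C1 * exp (- C2 * v)"
begin

abbreviation "F \<equiv> noise_filtration P x M"

lemma space_F [simp]: "space (F n) = space P"
  by (simp add: noise_filtration_def space_measure_of_conv)

lemma sets_F: "sets (F n) = sigma_sets (space P)
       ({x 0 -` A \<inter> space P | A. A \<in> sets borel} \<union>
        {M k -` A \<inter> space P | k A. k \<in> {1..n} \<and> A \<in> sets borel})"
  unfolding noise_filtration_def by (intro sets_measure_of) auto

lemma sets_F_mono: "m \<le> n \<Longrightarrow> sets (F m) \<subseteq> sets (F n)"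
  unfolding sets_F
  by (rule sigma_sets_mono', rule Un_mono, rule subset_refl, intro subsetI,
      elim CollectE exE conjE, intro CollectI exI conjI) auto

lemma sets_F_subset: "sets (F n) \<subseteq> sets P"
  unfolding sets_F using x0_meas M_meas
  by (intro sets.sigma_sets_subset) (auto intro: measurable_sets)

lemma subalgebra_F: "subalgebra P (F n)"
  by (simp add: subalgebra_def sets_F_subset)

lemma measurable_F_P: "f \<in> measurable (F n) N \<Longrightarrow> f \<in> measurable P N"
  using subalgebra_F by (rule measurable_from_subalg)

lemma M_F: "1 \<le> k \<Longrightarrow> k \<le> n \<Longrightarrow> M k \<in> borel_measurable (F n)"
  by (rule measurableI) (auto simp: sets_F intro!: sigma_sets.Basic)

lemma x_F: "k \<le> n \<Longrightarrow> x k \<in> borel_measurable (F n)"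
proof (induction k)
  case 0
  show ?case by (rule measurableI) (auto simp: sets_F intro!: sigma_sets.Basic)
next
  case (Suc k)
  then have [measurable]: "x k \<in> borel_measurable (F n)" by simp
  have [measurable]: "M (Suc k) \<in> borel_measurable (F n)" using Suc by (intro M_F) auto
  have [measurable]: "h \<in> borel_measurable borel"
    using h_cont by (rule borel_measurable_continuous_onI)
  have "(\<lambda>\<omega>. x k \<omega> + a k *\<^sub>R (h (x k \<omega>) + M (Suc k) \<omega>)) \<in> borel_measurable (F n)" by measurable
  then show ?case using iterates by (subst measurable_cong[of "F n"]) auto
qed

lemma x_meas [measurable]: "x n \<in> borel_measurable P"
  using x_F[of n n] by (auto intro: measurable_F_P)

text \<open>
  Integrating the conditional tail bound against a past-measurable \<open>Z\<close> gives the hypothesis of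
  \<open>exp_moment_of_tail\<close>.
\<close>
lemma exp_moment_of_scaled_noise:
  shows "\<exists>K>0. \<forall>n Z. Z \<in> borel_measurable (F n) \<longrightarrow> integrable P Z \<longrightarrow> (\<forall>\<omega>. 0 \<le> Z \<omega>) \<longrightarrow>
       integrable P (\<lambda>\<omega>. Z \<omega> * exp (C2 / 2 * (norm (M (Suc n) \<omega>) / (1 + norm (x n \<omega>)))))
       \<and> (\<integral>\<omega>. Z \<omega> * exp (C2 / 2 * (norm (M (Suc n) \<omega>) / (1 + norm (x n \<omega>)))) \<partial>P) \<le> K * (\<integral>\<omega>. Z \<omega> \<partial>P)"
proof -
  obtain v0 where v0: "\<And>v i. v0 \<le> v \<Longrightarrow> AE \<omega> in P.
             real_cond_exp P (F i)
               (indicator {\<omega> \<in> space P. norm (M (Suc i) \<omega>) / (1 + norm (x i \<omega>)) > v}) \<omega>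
               \<le> C1 * exp (- C2 * v)"
    using M_tail by blast
  obtain k0 :: nat where k0: "v0 \<le> k0" using real_arch_simple by blast
  define K where "K = exp (C2 / 2 * k0) + C1 * exp (C2 / 2) / (1 - exp (- C2 / 2))"
  have "0 < K" using C_pos by (simp add: K_def add_pos_nonneg)
  moreover have "integrable P (\<lambda>\<omega>. Z \<omega> * exp (C2 / 2 * (norm (M (Suc n) \<omega>) / (1 + norm (x n \<omega>)))))
       \<and> (\<integral>\<omega>. Z \<omega> * exp (C2 / 2 * (norm (M (Suc n) \<omega>) / (1 + norm (x n \<omega>)))) \<partial>P) \<le> K * (\<integral>\<omega>. Z \<omega> \<partial>P)"
    if Z: "Z \<in> borel_measurable (F n)" "integrable P Z" "\<And>\<omega>. 0 \<le> Z \<omega>" for n Z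
  proof -
    interpret F: finite_measure_subalgebra P "F n"
      by unfold_locales (rule subalgebra_F)
    have [measurable]: "M (Suc n) \<in> borel_measurable P" by (rule M_meas) simp
    define \<xi> where "\<xi> \<omega> = norm (M (Suc n) \<omega>) / (1 + norm (x n \<omega>))" for \<omega>
    have [measurable]: "\<xi> \<in> borel_measurable P" unfolding \<xi>_def by measurable
    have tail: "(\<integral>\<omega>. Z \<omega> * indicator {\<omega> \<in> space P. real k < \<xi> \<omega>} \<omega> \<partial>P) \<le> C1 * exp (- C2 * k) * (\<integral>\<omega>. Z \<omega> \<partial>P)"
      if k: "k0 \<le> k" for k
    proof -
      define U where "U = {\<omega> \<in> space P. real k < \<xi> \<omega>}"
      have [measurable]: "U \<in> sets P" unfolding U_def by measurable
      have int: "integrable P (\<lambda>\<omega>. Z \<omega> * indicator U \<omega>)"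
        using Z(2) by (intro integrable_real_mult_indicator) auto
      have U_meas: "(indicator U :: _ \<Rightarrow> real) \<in> borel_measurable P" by measurable
      note ce = F.real_cond_exp_intg[OF int Z(1) U_meas]
      have "(\<integral>\<omega>. Z \<omega> * indicator U \<omega> \<partial>P) = (\<integral>\<omega>. Z \<omega> * real_cond_exp P (F n) (indicator U) \<omega> \<partial>P)"
        using ce(2) by simp
      also have "\<dots> \<le> (\<integral>\<omega>. Z \<omega> * (C1 * exp (- C2 * k)) \<partial>P)"
      proof (rule integral_mono_AE[OF ce(1)])
        have "v0 \<le> real k" using k0 k by (meson of_nat_mono order_trans)
        from v0[OF this, of n]
        show "AE \<omega> in P. Z \<omega> * real_cond_exp P (F n) (indicator U) \<omega> \<le> Z \<omega> * (C1 * exp (- C2 * k))"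
          using Z(3) by (auto simp: U_def \<xi>_def intro: mult_left_mono)
      qed (use Z(2) in simp)
      finally show ?thesis by (simp add: U_def mult_ac)
    qed
    show ?thesis
      using exp_moment_of_tail[OF Z(2,3) \<open>\<xi> \<in> borel_measurable P\<close> C_pos(2,1) tail]
      unfolding K_def \<xi>_def by auto
  qed
  ultimately show ?thesis by blast
qed

text \<open>
  On a past event where \<open>\<parallel>x n\<parallel> \<le> r\<close> the noise itself has conditional exponential moments. In
  \<open>exp s \<le> 1 + s + s\<^sup>2 exp \<bar>s\<bar>\<close> the linear term has conditional mean 0, so a small multiple \<open>u\<close> of the
  noise costs a factor of only \<open>1 + Q u\<^sup>2\<close>.
\<close>
lemma exp_moment_step:
  fixes r :: real
  assumes "0 \<le> r"
  shows "\<exists>Q\<ge>0. \<forall>n Z J l u. Z \<in> borel_measurable (F n) \<longrightarrow> integrable P Z \<longrightarrow> (\<forall>\<omega>. 0 \<le> Z \<omega>) \<longrightarrow>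
       J \<in> sets (F n) \<longrightarrow> (\<forall>\<omega>\<in>J. norm (x n \<omega>) \<le> r) \<longrightarrow> \<bar>u\<bar> * (1 + r) \<le> C2 / 4 \<longrightarrow>
       integrable P (\<lambda>\<omega>. Z \<omega> * exp (u * (indicator J \<omega> * M (Suc n) \<omega> $ l)))
       \<and> (\<integral>\<omega>. Z \<omega> * exp (u * (indicator J \<omega> * M (Suc n) \<omega> $ l)) \<partial>P) \<le> (1 + Q * u\<^sup>2) * (\<integral>\<omega>. Z \<omega> \<partial>P)"
proof -
  obtain K where K: "0 < K"
    "\<forall>n Z. Z \<in> borel_measurable (F n) \<longrightarrow> integrable P Z \<longrightarrow> (\<forall>\<omega>. 0 \<le> Z \<omega>) \<longrightarrow>
       integrable P (\<lambda>\<omega>. Z \<omega> * exp (C2 / 2 * (norm (M (Suc n) \<omega>) / (1 + norm (x n \<omega>)))))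
       \<and> (\<integral>\<omega>. Z \<omega> * exp (C2 / 2 * (norm (M (Suc n) \<omega>) / (1 + norm (x n \<omega>)))) \<partial>P) \<le> K * (\<integral>\<omega>. Z \<omega> \<partial>P)"
    using exp_moment_of_scaled_noise by blast
  \<comment> \<open>The rate \<open>C2 / 2\<close> is split in two: \<open>C2 / 4\<close> dominates \<open>exp \<bar>s\<bar>\<close>, and \<open>C2 / 4\<close> dominates \<open>s\<^sup>2\<close>.\<close>
  define q where "q = 32 * (1 + r)\<^sup>2 / C2\<^sup>2"
  have q: "0 \<le> q" by (simp add: q_def)
  have "integrable P (\<lambda>\<omega>. Z \<omega> * exp (u * (indicator J \<omega> * M (Suc n) \<omega> $ l)))
       \<and> (\<integral>\<omega>. Z \<omega> * exp (u * (indicator J \<omega> * M (Suc n) \<omega> $ l)) \<partial>P) \<le> (1 + (q * K) * u\<^sup>2) * (\<integral>\<omega>. Z \<omega> \<partial>P)"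
    if Z: "Z \<in> borel_measurable (F n)" "integrable P Z" "\<And>\<omega>. 0 \<le> Z \<omega>"
      and J: "J \<in> sets (F n)" and xr: "\<And>\<omega>. \<omega> \<in> J \<Longrightarrow> norm (x n \<omega>) \<le> r"
      and u: "\<bar>u\<bar> * (1 + r) \<le> C2 / 4" for n Z J l u
  proof -
    interpret F: finite_measure_subalgebra P "F n"
      by unfold_locales (rule subalgebra_F)
    have [measurable]: "M (Suc n) \<in> borel_measurable P" by (rule M_meas) simp
    have ZP [measurable]: "Z \<in> borel_measurable P" using Z(1) by (rule measurable_F_P)
    have JP [measurable]: "J \<in> sets P" using J sets_F_subset by blast
    define \<xi> where "\<xi> \<omega> = norm (M (Suc n) \<omega>) / (1 + norm (x n \<omega>))" for \<omega>
    have \<xi>0: "0 \<le> \<xi> \<omega>" for \<omega> by (simp add: \<xi>_def)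
    have \<xi>_int: "integrable P (\<lambda>\<omega>. Z \<omega> * exp (C2 / 2 * \<xi> \<omega>))"
      and \<xi>_le: "(\<integral>\<omega>. Z \<omega> * exp (C2 / 2 * \<xi> \<omega>) \<partial>P) \<le> K * (\<integral>\<omega>. Z \<omega> \<partial>P)"
      using K(2) Z by (auto simp: \<xi>_def)
    define X where "X \<omega> = indicator J \<omega> * M (Suc n) \<omega> $ l" for \<omega>
    have [measurable]: "X \<in> borel_measurable P" unfolding X_def by measurable
    have X_le: "\<bar>X \<omega>\<bar> \<le> (1 + r) * \<xi> \<omega>" for \<omega>
    proof (cases "\<omega> \<in> J")
      case True
      have "\<bar>X \<omega>\<bar> \<le> norm (M (Suc n) \<omega>)" using True component_le_norm_cart by (auto simp: X_def)
      also have "\<dots> = (1 + norm (x n \<omega>)) * \<xi> \<omega>"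
      proof -
        have "1 + norm (x n \<omega>) \<noteq> 0" using norm_ge_zero[of "x n \<omega>"] by linarith
        then show ?thesis by (simp add: \<xi>_def)
      qed
      also have "\<dots> \<le> (1 + r) * \<xi> \<omega>" using xr[OF True] \<xi>0 by (intro mult_right_mono) auto
      finally show ?thesis .
    qed (use \<xi>0 \<open>0 \<le> r\<close> in \<open>simp add: X_def\<close>)
    have uX: "\<bar>u * X \<omega>\<bar> \<le> C2 / 4 * \<xi> \<omega>" for \<omega>
    proof -
      have "\<bar>u * X \<omega>\<bar> \<le> \<bar>u\<bar> * ((1 + r) * \<xi> \<omega>)"
        unfolding abs_mult by (intro mult_left_mono X_le) auto
      also have "\<dots> = (\<bar>u\<bar> * (1 + r)) * \<xi> \<omega>" by simp
      also have "\<dots> \<le> C2 / 4 * \<xi> \<omega>" using u \<xi>0 by (rule mult_right_mono)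
      finally show ?thesis .
    qed
    have half: "C2 / 4 * \<xi> \<omega> \<le> C2 / 2 * \<xi> \<omega>" for \<omega>
      using C_pos \<xi>0[of \<omega>] by (intro mult_right_mono) auto
    have rem: "(u * X \<omega>)\<^sup>2 * exp \<bar>u * X \<omega>\<bar> \<le> q * u\<^sup>2 * exp (C2 / 2 * \<xi> \<omega>)" for \<omega>
    proof -
      define s where "s = C2 / 4 * \<xi> \<omega>"
      have s: "0 \<le> s" using C_pos \<xi>0 by (simp add: s_def)
      have "(u * X \<omega>)\<^sup>2 \<le> (\<bar>u\<bar> * ((1 + r) * \<xi> \<omega>))\<^sup>2"
        unfolding power_mult_distrib[of u] power_mult_distrib[of "\<bar>u\<bar>"] power2_abs
        using X_le[of \<omega>] by (intro mult_left_mono) (auto intro: power2_le_iff_abs_le[THEN iffD2] order_trans)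
      also have "\<dots> = u\<^sup>2 * (q / 2) * s\<^sup>2"
        using C_pos by (simp add: q_def s_def power_mult_distrib power_divide)
      also have "\<dots> \<le> u\<^sup>2 * (q / 2) * (2 * exp s)"
        using q square_le_exp[OF s] by (intro mult_left_mono) auto
      finally have "(u * X \<omega>)\<^sup>2 * exp \<bar>u * X \<omega>\<bar> \<le> (u\<^sup>2 * (q / 2) * (2 * exp s)) * exp s"
        using uX[of \<omega>] q by (intro mult_mono) (auto simp: s_def)
      also have "\<dots> = q * u\<^sup>2 * exp (2 * s)" by (simp add: exp_double power2_eq_square)
      finally show ?thesis by (simp add: s_def)
    qed
    have int_exp: "integrable P (\<lambda>\<omega>. Z \<omega> * exp (u * X \<omega>))"
    proof (rule Bochner_Integration.integrable_bound[OF \<xi>_int])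
      have "exp (u * X \<omega>) \<le> exp (C2 / 2 * \<xi> \<omega>)" for \<omega>
        using uX[of \<omega>] half[of \<omega>] by simp
      then show "AE \<omega> in P. norm (Z \<omega> * exp (u * X \<omega>)) \<le> norm (Z \<omega> * exp (C2 / 2 * \<xi> \<omega>))"
        using Z(3) by (auto simp: abs_mult intro!: mult_left_mono)
    qed measurable
    have int_lin: "integrable P (\<lambda>\<omega>. Z \<omega> * (u * X \<omega>))"
    proof (rule Bochner_Integration.integrable_bound[OF \<xi>_int])
      have "\<bar>u * X \<omega>\<bar> \<le> exp (C2 / 2 * \<xi> \<omega>)" for \<omega>
        using uX[of \<omega>] half[of \<omega>] exp_ge_add_one_self[of "C2 / 2 * \<xi> \<omega>"] by linarith
      then have "\<bar>Z \<omega>\<bar> * \<bar>u * X \<omega>\<bar> \<le> \<bar>Z \<omega>\<bar> * exp (C2 / 2 * \<xi> \<omega>)" for \<omega>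
        by (intro mult_left_mono) auto
      then show "AE \<omega> in P. norm (Z \<omega> * (u * X \<omega>)) \<le> norm (Z \<omega> * exp (C2 / 2 * \<xi> \<omega>))"
        by (auto simp: abs_mult)
    qed measurable
    have lin0: "(\<integral>\<omega>. Z \<omega> * (u * X \<omega>) \<partial>P) = 0"
    proof -
      define G where "G \<omega> = u * (Z \<omega> * indicator J \<omega>)" for \<omega>
      have G: "G \<in> borel_measurable (F n)"
        unfolding G_def using Z(1) J by measurable
      have GX: "(\<lambda>\<omega>. Z \<omega> * (u * X \<omega>)) = (\<lambda>\<omega>. G \<omega> * M (Suc n) \<omega> $ l)"
        by (simp add: fun_eq_iff G_def X_def)
      have Ml: "(\<lambda>\<omega>. M (Suc n) \<omega> $ l) \<in> borel_measurable P" by measurable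
      have "(\<integral>\<omega>. G \<omega> * M (Suc n) \<omega> $ l \<partial>P) = (\<integral>\<omega>. G \<omega> * real_cond_exp P (F n) (\<lambda>\<omega>. M (Suc n) \<omega> $ l) \<omega> \<partial>P)"
        using F.real_cond_exp_intg(2)[OF int_lin[unfolded GX] G Ml] by simp
      also have "\<dots> = (\<integral>\<omega>. 0 \<partial>P)"
      proof (rule integral_cong_AE)
        show "AE \<omega> in P. G \<omega> * real_cond_exp P (F n) (\<lambda>\<omega>. M (Suc n) \<omega> $ l) \<omega> = 0"
          using M_mds[of n l] by auto
        have [measurable]: "G \<in> borel_measurable P" using G by (rule measurable_F_P)
        show "(\<lambda>\<omega>. G \<omega> * real_cond_exp P (F n) (\<lambda>\<omega>. M (Suc n) \<omega> $ l) \<omega>) \<in> borel_measurable P"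
          by measurable
      qed simp
      finally show ?thesis by (simp add: GX)
    qed
    have "(\<integral>\<omega>. Z \<omega> * exp (u * X \<omega>) \<partial>P)
        \<le> (\<integral>\<omega>. Z \<omega> + Z \<omega> * (u * X \<omega>) + q * u\<^sup>2 * (Z \<omega> * exp (C2 / 2 * \<xi> \<omega>)) \<partial>P)"
    proof (rule integral_mono)
      fix \<omega>
      have "exp (u * X \<omega>) \<le> 1 + u * X \<omega> + q * u\<^sup>2 * exp (C2 / 2 * \<xi> \<omega>)"
        using exp_le_quadratic_remainder[of "u * X \<omega>"] rem[of \<omega>] by linarith
      from mult_left_mono[OF this Z(3)[of \<omega>]]
      show "Z \<omega> * exp (u * X \<omega>) \<le> Z \<omega> + Z \<omega> * (u * X \<omega>) + q * u\<^sup>2 * (Z \<omega> * exp (C2 / 2 * \<xi> \<omega>))"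
        by (simp add: algebra_simps)
    qed (intro int_exp Bochner_Integration.integrable_add Z(2) int_lin integrable_mult_right \<xi>_int)+
    also have "\<dots> = (\<integral>\<omega>. Z \<omega> \<partial>P) + q * u\<^sup>2 * (\<integral>\<omega>. Z \<omega> * exp (C2 / 2 * \<xi> \<omega>) \<partial>P)"
      using Z(2) int_lin \<xi>_int lin0 by simp
    also have "\<dots> \<le> (\<integral>\<omega>. Z \<omega> \<partial>P) + q * u\<^sup>2 * (K * (\<integral>\<omega>. Z \<omega> \<partial>P))"
      using q \<xi>_le by (intro add_left_mono mult_left_mono) auto
    finally show ?thesis using int_exp by (simp add: X_def algebra_simps)
  qed
  moreover have "0 \<le> q * K" using q K(1) by simp
  ultimately show ?thesis by blast
qed

end

section \<open>Concentration of the noise within a block\<close>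

context noisy_recursion
begin

definition noise_sum :: "nat \<Rightarrow> nat \<Rightarrow> 'w \<Rightarrow> real ^ 'd" where
  "noise_sum n i \<omega> = (\<Sum>k<i. a (n + k) *\<^sub>R M (n + k + 1) \<omega>)"

lemma noise_sum_F: "n + i \<le> m \<Longrightarrow> noise_sum n i \<in> borel_measurable (F m)"
  unfolding noise_sum_def[abs_def]
  by (intro borel_measurable_sum borel_measurable_scaleR borel_measurable_const M_F) auto

text \<open>
  Before the first time the partial noise sums exceed \<open>\<eta>\<close> the iterates have norm at most \<open>r\<close>. Stopping the
  sums at that time therefore leaves a martingale whose increments obey \<open>exp_moment_step\<close>, and the stopped sum
  at the end of the block still exceeds \<open>\<eta>\<close> if the original one ever did, which makes a maximal
  inequality unnecessary. The Chernoff parameter is of order \<open>1 / sqrt b\<close>, with \<open>b\<close> the sum of the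
  squared steps: the largest value that keeps the factor \<open>exp (Q u\<^sup>2 b)\<close> bounded and, as no single
  step exceeds \<open>sqrt b\<close>, every increment within reach of the exponential moment.
  The estimate is relative to an arbitrary event \<open>A\<close> of the past, which is what makes it usable
  conditionally on \<open>x n0 \<in> B\<close> with constants independent of \<open>n0\<close>.
\<close>
lemma block_concentration:
  fixes r \<eta> :: real
  assumes "0 \<le> r" "0 < \<eta>"
  shows "\<exists>K>0. \<exists>c>0. \<forall>n N A. A \<in> sets (F n) \<longrightarrow> 0 < N \<longrightarrow>
      (\<forall>\<omega>\<in>A. \<forall>j<N. (\<forall>i\<le>j. norm (noise_sum n i \<omega>) \<le> \<eta>) \<longrightarrow> norm (x (n + j) \<omega>) \<le> r) \<longrightarrow>
      prob {\<omega> \<in> A. \<exists>i\<le>N. \<eta> < norm (noise_sum n i \<omega>)}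
        \<le> K * exp (- (c / sqrt (\<Sum>k<N. (a (n + k))\<^sup>2))) * prob A"
proof -
  obtain Q where Q: "0 \<le> Q"
    "\<forall>n Z J l u. Z \<in> borel_measurable (F n) \<longrightarrow> integrable P Z \<longrightarrow> (\<forall>\<omega>. 0 \<le> Z \<omega>) \<longrightarrow>
       J \<in> sets (F n) \<longrightarrow> (\<forall>\<omega>\<in>J. norm (x n \<omega>) \<le> r) \<longrightarrow> \<bar>u\<bar> * (1 + r) \<le> C2 / 4 \<longrightarrow>
       integrable P (\<lambda>\<omega>. Z \<omega> * exp (u * (indicator J \<omega> * M (Suc n) \<omega> $ l)))
       \<and> (\<integral>\<omega>. Z \<omega> * exp (u * (indicator J \<omega> * M (Suc n) \<omega> $ l)) \<partial>P) \<le> (1 + Q * u\<^sup>2) * (\<integral>\<omega>. Z \<omega> \<partial>P)"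
    using exp_moment_step[OF \<open>0 \<le> r\<close>] by blast
  define \<kappa> where "\<kappa> = C2 / (4 * (1 + r))"
  define d where "d = real CARD('d)"
  define K where "K = 2 * d * exp (Q * \<kappa>\<^sup>2)"
  define c where "c = \<kappa> * \<eta> / d"
  have d: "0 < d" by (simp add: d_def)
  have \<kappa>: "0 < \<kappa>" using C_pos \<open>0 \<le> r\<close> by (simp add: \<kappa>_def)
  have "0 < K" "0 < c" using d \<kappa> \<open>0 < \<eta>\<close> by (simp_all add: K_def c_def)
  moreover have "prob {\<omega> \<in> A. \<exists>i\<le>N. \<eta> < norm (noise_sum n i \<omega>)}
        \<le> K * exp (- (c / sqrt (\<Sum>k<N. (a (n + k))\<^sup>2))) * prob A"
    if A: "A \<in> sets (F n)" and "0 < N"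
      and bdd: "\<forall>\<omega>\<in>A. \<forall>j<N. (\<forall>i\<le>j. norm (noise_sum n i \<omega>) \<le> \<eta>) \<longrightarrow> norm (x (n + j) \<omega>) \<le> r"
    for n N A
  proof -
    define b where "b = (\<Sum>k<N. (a (n + k))\<^sup>2)"
    have a_le: "a (n + k) \<le> sqrt b" if "k < N" for k
    proof -
      have "(a (n + k))\<^sup>2 \<le> b" unfolding b_def using that by (intro member_le_sum) auto
      then show ?thesis by (rule real_le_rsqrt)
    qed
    have sb: "0 < sqrt b" using a_le[OF \<open>0 < N\<close>] step_pos[of "n + 0"] by linarith
    define J where "J j = {\<omega> \<in> A. \<forall>i\<le>j. norm (noise_sum n i \<omega>) \<le> \<eta>}" for j
    have A_space: "A \<subseteq> space P" using sets.sets_into_space[OF A] by simp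
    have J: "J j \<in> sets (F (n + j))" for j
    proof -
      have "{\<omega> \<in> space (F (n + j)). norm (noise_sum n i \<omega>) \<le> \<eta>} \<in> sets (F (n + j))" if "i \<le> j" for i
      proof -
        have [measurable]: "noise_sum n i \<in> borel_measurable (F (n + j))"
          using that by (intro noise_sum_F) auto
        show ?thesis by measurable
      qed
      moreover have "A \<in> sets (F (n + j))" using A sets_F_mono[of n "n + j"] by auto
      moreover have "J j = A \<inter> (\<Inter>i\<in>{..j}. {\<omega> \<in> space (F (n + j)). norm (noise_sum n i \<omega>) \<le> \<eta>})"
        using A_space by (auto simp: J_def)
      ultimately show ?thesis by (auto intro!: sets.Int sets.finite_INT)
    qed
    \<comment> \<open>The event \<open>J k\<close> is known before the increment \<open>k\<close>; hence \<open>W\<close> includes the increment that overshoots \<open>\<eta>\<close> and is constant afterwards.\<close>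
    define W where "W l j \<omega> = (\<Sum>k<j. a (n + k) * (indicator (J k) \<omega> * M (Suc (n + k)) \<omega> $ l))" for l j \<omega>
    have W_F: "W l j \<in> borel_measurable (F (n + j))" for l j
      unfolding W_def[abs_def]
    proof (intro borel_measurable_sum borel_measurable_times borel_measurable_const)
      fix k assume "k \<in> {..<j}"
      then have k: "n + k \<le> n + j" "Suc (n + k) \<le> n + j" by auto
      show "(indicator (J k) :: _ \<Rightarrow> real) \<in> borel_measurable (F (n + j))"
        using J[of k] sets_F_mono[OF k(1)] by (intro borel_measurable_indicator) auto
      show "(\<lambda>\<omega>. M (Suc (n + k)) \<omega> $ l) \<in> borel_measurable (F (n + j))"
        using k by (intro borel_measurable_component M_F) auto
    qed
    have mom: "integrable P (\<lambda>\<omega>. indicator A \<omega> * exp (u * W l j \<omega>)) \<and>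
        (\<integral>\<omega>. indicator A \<omega> * exp (u * W l j \<omega>) \<partial>P) \<le> exp (Q * u\<^sup>2 * (\<Sum>k<j. (a (n + k))\<^sup>2)) * prob A"
      if u: "\<bar>u\<bar> * sqrt b * (1 + r) \<le> C2 / 4" and "j \<le> N" for u l j
      using \<open>j \<le> N\<close>
    proof (induction j)
      case 0
      have "A \<in> sets P" using A sets_F_subset by blast
      then show ?case by (simp add: W_def emeasure_eq_measure)
    next
      case (Suc j)
      define Z where "Z \<omega> = indicator A \<omega> * exp (u * W l j \<omega>)" for \<omega>
      define u' where "u' = u * a (n + j)"
      have Z_int: "integrable P Z" and
        Z_le: "(\<integral>\<omega>. Z \<omega> \<partial>P) \<le> exp (Q * u\<^sup>2 * (\<Sum>k<j. (a (n + k))\<^sup>2)) * prob A"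
        using Suc by (auto simp: Z_def[abs_def])
      have [measurable]: "W l j \<in> borel_measurable (F (n + j))" by (rule W_F)
      have [measurable]: "A \<in> sets (F (n + j))" using A sets_F_mono[of n "n + j"] by auto
      have "Z \<in> borel_measurable (F (n + j))" unfolding Z_def by measurable
      moreover have "\<forall>\<omega>. 0 \<le> Z \<omega>" by (simp add: Z_def)
      moreover have "\<forall>\<omega>\<in>J j. norm (x (n + j) \<omega>) \<le> r" using bdd Suc.prems by (auto simp: J_def)
      moreover have "\<bar>u'\<bar> * (1 + r) \<le> C2 / 4"
      proof -
        have "\<bar>u'\<bar> \<le> \<bar>u\<bar> * sqrt b"
          using a_le[of j] Suc.prems step_pos[of "n + j"] by (auto simp: u'_def abs_mult intro!: mult_left_mono)
        then have "\<bar>u'\<bar> * (1 + r) \<le> \<bar>u\<bar> * sqrt b * (1 + r)"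
          using \<open>0 \<le> r\<close> by (intro mult_right_mono) auto
        then show ?thesis using u by linarith
      qed
      ultimately have step: "integrable P (\<lambda>\<omega>. Z \<omega> * exp (u' * (indicator (J j) \<omega> * M (Suc (n + j)) \<omega> $ l)))"
        "(\<integral>\<omega>. Z \<omega> * exp (u' * (indicator (J j) \<omega> * M (Suc (n + j)) \<omega> $ l)) \<partial>P) \<le> (1 + Q * u'\<^sup>2) * (\<integral>\<omega>. Z \<omega> \<partial>P)"
        using Q(2) Z_int J[of j] by blast+
      have eq: "(\<lambda>\<omega>. Z \<omega> * exp (u' * (indicator (J j) \<omega> * M (Suc (n + j)) \<omega> $ l)))
          = (\<lambda>\<omega>. indicator A \<omega> * exp (u * W l (Suc j) \<omega>))"
        by (simp add: fun_eq_iff Z_def u'_def W_def distrib_left exp_add mult_ac)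
      have "(1 + Q * u'\<^sup>2) * (\<integral>\<omega>. Z \<omega> \<partial>P)
          \<le> exp (Q * u'\<^sup>2) * (exp (Q * u\<^sup>2 * (\<Sum>k<j. (a (n + k))\<^sup>2)) * prob A)"
        using Q(1) by (intro mult_mono exp_ge_add_one_self Z_le) (auto simp: Z_def)
      also have "\<dots> = exp (Q * u\<^sup>2 * (\<Sum>k<Suc j. (a (n + k))\<^sup>2)) * prob A"
        by (simp add: u'_def power_mult_distrib distrib_left exp_add)
      finally show ?case using step unfolding eq by auto
    qed
    have tail: "prob {\<omega> \<in> A. \<eta> / d < s * W l N \<omega>} \<le> exp (- (c / sqrt b)) * exp (Q * \<kappa>\<^sup>2) * prob A"
      and tail_meas: "{\<omega> \<in> A. \<eta> / d < s * W l N \<omega>} \<in> sets P" if s: "s \<in> {1, -1}" for s :: real and l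
    proof -
      define u where "u = s * (\<kappa> / sqrt b)"
      have "\<bar>u\<bar> = \<kappa> / sqrt b" using s \<kappa> sb by (auto simp: u_def abs_mult)
      then have "\<bar>u\<bar> * sqrt b * (1 + r) = \<kappa> * (1 + r)" using sb by simp
      also have "\<dots> = C2 / 4" using \<open>0 \<le> r\<close> by (simp add: \<kappa>_def divide_simps)
      finally have "\<bar>u\<bar> * sqrt b * (1 + r) \<le> C2 / 4" by simp
      from mom[OF this order_refl]
      have int: "integrable P (\<lambda>\<omega>. indicator A \<omega> * exp (u * W l N \<omega>))"
        and le: "(\<integral>\<omega>. indicator A \<omega> * exp (u * W l N \<omega>) \<partial>P) \<le> exp (Q * u\<^sup>2 * b) * prob A"
        by (auto simp: b_def)
      have "u\<^sup>2 * b = \<kappa>\<^sup>2" using s sb by (auto simp: u_def power_mult_distrib power_divide)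
      then have le: "(\<integral>\<omega>. indicator A \<omega> * exp (u * W l N \<omega>) \<partial>P) \<le> exp (Q * \<kappa>\<^sup>2) * prob A"
        using le by (simp add: mult.assoc)
      define E where "E = {\<omega> \<in> A. \<eta> / d < s * W l N \<omega>}"
      have [measurable]: "W l N \<in> borel_measurable P" using W_F by (rule measurable_F_P)
      have [measurable]: "A \<in> sets P" using A sets_F_subset by blast
      have "E = A \<inter> {\<omega> \<in> space P. \<eta> / d < s * W l N \<omega>}" using A_space by (auto simp: E_def)
      then show "{\<omega> \<in> A. \<eta> / d < s * W l N \<omega>} \<in> sets P" unfolding E_def by simp
      then have E_meas: "E \<in> sets P" by (simp add: E_def)
      have "prob E = (\<integral>\<omega>. indicator E \<omega> \<partial>P)" using E_meas by simp
      also have "\<dots> \<le> (\<integral>\<omega>. exp (- (c / sqrt b)) * (indicator A \<omega> * exp (u * W l N \<omega>)) \<partial>P)"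
      proof (rule integral_mono)
        show "integrable P (indicator E :: _ \<Rightarrow> real)" using E_meas by (simp add: emeasure_eq_measure)
        show "integrable P (\<lambda>\<omega>. exp (- (c / sqrt b)) * (indicator A \<omega> * exp (u * W l N \<omega>)))"
          using int by simp
        fix \<omega>
        show "indicator E \<omega> \<le> exp (- (c / sqrt b)) * (indicator A \<omega> * exp (u * W l N \<omega>))"
        proof (cases "\<omega> \<in> E")
          case True
          have "c / sqrt b = \<kappa> / sqrt b * (\<eta> / d)" by (simp add: c_def)
          also have "\<dots> \<le> \<kappa> / sqrt b * (s * W l N \<omega>)"
            using True \<kappa> sb by (intro mult_left_mono) (auto simp: E_def)
          also have "\<dots> = u * W l N \<omega>" by (simp add: u_def)
          finally show ?thesis using True by (simp add: E_def mult_exp_exp)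
        qed simp
      qed
      also have "\<dots> = exp (- (c / sqrt b)) * (\<integral>\<omega>. indicator A \<omega> * exp (u * W l N \<omega>) \<partial>P)" by simp
      also have "\<dots> \<le> exp (- (c / sqrt b)) * (exp (Q * \<kappa>\<^sup>2) * prob A)"
        by (intro mult_left_mono le) auto
      finally show "prob {\<omega> \<in> A. \<eta> / d < s * W l N \<omega>} \<le> exp (- (c / sqrt b)) * exp (Q * \<kappa>\<^sup>2) * prob A"
        by (simp add: E_def)
    qed
    \<comment> \<open>Some coordinate of a vector of norm greater than \<open>\<eta>\<close> exceeds \<open>\<eta> / d\<close> in absolute value.\<close>
    define U where "U p = {\<omega> \<in> A. \<eta> / d < snd p * W (fst p) N \<omega>}" for p :: "'d \<times> real"
    have U_meas: "U p \<in> sets P" and U_tail: "prob (U p) \<le> exp (- (c / sqrt b)) * exp (Q * \<kappa>\<^sup>2) * prob A"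
      if "p \<in> UNIV \<times> {1, -1}" for p
    proof -
      have s: "snd p \<in> {1, -1}" using that by (simp add: mem_Times_iff)
      show "U p \<in> sets P" unfolding U_def by (rule tail_meas[OF s])
      show "prob (U p) \<le> exp (- (c / sqrt b)) * exp (Q * \<kappa>\<^sup>2) * prob A"
        unfolding U_def by (rule tail[OF s])
    qed
    have "{\<omega> \<in> A. \<exists>i\<le>N. \<eta> < norm (noise_sum n i \<omega>)} \<subseteq> (\<Union>p\<in>UNIV \<times> {1, -1}. U p)"
    proof
      fix \<omega> assume "\<omega> \<in> {\<omega> \<in> A. \<exists>i\<le>N. \<eta> < norm (noise_sum n i \<omega>)}"
      then have \<omega>: "\<omega> \<in> A" and ex: "\<exists>i. i \<le> N \<and> \<eta> < norm (noise_sum n i \<omega>)" by auto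
      define i where "i = (LEAST i. i \<le> N \<and> \<eta> < norm (noise_sum n i \<omega>))"
      have i: "i \<le> N" "\<eta> < norm (noise_sum n i \<omega>)"
        using LeastI_ex[OF ex] by (auto simp: i_def)
      have before: "norm (noise_sum n k \<omega>) \<le> \<eta>" if "k < i" for k
        using not_less_Least[of k "\<lambda>i. i \<le> N \<and> \<eta> < norm (noise_sum n i \<omega>)"] that i(1)
        by (auto simp: i_def not_less)
      have Jk: "\<omega> \<in> J k \<longleftrightarrow> k < i" for k
      proof
        assume "\<omega> \<in> J k"
        then have "\<not> i \<le> k" using i(2) by (auto simp: J_def not_le)
        then show "k < i" by simp
      next
        assume "k < i"
        then show "\<omega> \<in> J k" using \<omega> before by (auto simp: J_def)
      qed
      have W_eq: "W l N \<omega> = noise_sum n i \<omega> $ l" for l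
      proof -
        have "W l N \<omega> = (\<Sum>k<i. a (n + k) * (indicator (J k) \<omega> * M (Suc (n + k)) \<omega> $ l))"
          unfolding W_def using i(1) by (intro sum.mono_neutral_right) (auto simp: Jk)
        also have "\<dots> = (\<Sum>k<i. a (n + k) * M (Suc (n + k)) \<omega> $ l)"
          by (intro sum.cong) (auto simp: Jk)
        finally show ?thesis by (simp add: noise_sum_def sum_component)
      qed
      have "\<exists>l. \<eta> / d < \<bar>noise_sum n i \<omega> $ l\<bar>"
      proof (rule ccontr)
        assume "\<not> ?thesis"
        then have "(\<Sum>l\<in>UNIV. \<bar>noise_sum n i \<omega> $ l\<bar>) \<le> (\<Sum>l\<in>(UNIV :: 'd set). \<eta> / d)"
          by (intro sum_mono) (auto simp: not_less)
        also have "\<dots> = \<eta>" using d by (simp add: d_def)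
        finally show False using i(2) norm_le_l1_cart[of "noise_sum n i \<omega>"] by linarith
      qed
      then obtain l where "\<eta> / d < \<bar>W l N \<omega>\<bar>" using W_eq by auto
      then have "\<omega> \<in> U (l, 1) \<or> \<omega> \<in> U (l, -1)" using \<omega> by (auto simp: U_def abs_if split: if_splits)
      then show "\<omega> \<in> (\<Union>p\<in>UNIV \<times> {1, -1}. U p)" by auto
    qed
    then have "prob {\<omega> \<in> A. \<exists>i\<le>N. \<eta> < norm (noise_sum n i \<omega>)} \<le> prob (\<Union>p\<in>UNIV \<times> {1, -1}. U p)"
      by (rule finite_measure_mono, intro sets.finite_UN) (auto intro: U_meas)
    also have "\<dots> \<le> (\<Sum>p\<in>UNIV \<times> {1, -1}. prob (U p))"
      by (rule measure_UNION_le) (auto intro: U_meas)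
    also have "\<dots> \<le> (\<Sum>p\<in>(UNIV :: 'd set) \<times> {1, -1 :: real}. exp (- (c / sqrt b)) * exp (Q * \<kappa>\<^sup>2) * prob A)"
      by (rule sum_mono) (rule U_tail)
    also have "\<dots> = K * exp (- (c / sqrt b)) * prob A"
      by (simp add: K_def d_def card_cartesian_product)
    finally show ?thesis by (simp add: b_def)
  qed
  ultimately show ?thesis by blast
qed

end

section \<open>Measurability of confinement\<close>

text \<open>
  Confinement is a condition at uncountably many times. On each segment of the path, compactness of
  the time interval turns it into an open condition on the two end points.
\<close>
lemma (in divergent_steps) eventually_confined_measurable:
  fixes z :: "nat \<Rightarrow> 'w \<Rightarrow> 'v::euclidean_space"
  assumes z: "\<And>n. z n \<in> borel_measurable P" and U: "open U" and "0 \<le> s"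
  shows "{\<omega> \<in> space P. \<forall>t\<ge>s. interpolate a (\<lambda>n. z n \<omega>) t \<in> U} \<in> sets P"
proof -
  define seg where "seg n t w = fst w + ((t - sa_time a n) / a n) *\<^sub>R (snd w - fst w)"
    for n t and w :: "'v \<times> 'v"
  define G where "G n = {w. \<forall>t\<in>{max s (sa_time a n)..sa_time a (Suc n)}. seg n t w \<in> U}" for n
  have "open (G n)" for n
  proof -
    have "continuous_on UNIV (\<lambda>p :: real \<times> 'v \<times> 'v. seg n (fst p) (snd p))"
      unfolding seg_def using step_pos[of n] by (intro continuous_intros) auto
    then have "closed ((\<lambda>p. seg n (fst p) (snd p)) -` (- U))"
      using U by (intro continuous_closed_vimage) (auto simp: continuous_on_eq_continuous_at closed_Compl)
    from closed_compact_projection[OF compact_Icc[of "max s (sa_time a n)" "sa_time a (Suc n)"] this]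
    have "closed {w. \<exists>t. t \<in> {max s (sa_time a n)..sa_time a (Suc n)} \<and> seg n t w \<notin> U}" by simp
    moreover have "- G n = {w. \<exists>t. t \<in> {max s (sa_time a n)..sa_time a (Suc n)} \<and> seg n t w \<notin> U}"
      by (auto simp: G_def)
    ultimately show ?thesis by (simp add: open_closed)
  qed
  have "{\<omega> \<in> space P. (z n \<omega>, z (Suc n) \<omega>) \<in> G n} \<in> sets P" for n
  proof -
    have "(\<lambda>\<omega>. (z n \<omega>, z (Suc n) \<omega>)) \<in> borel_measurable P" by (intro borel_measurable_Pair z)
    moreover have "G n \<in> sets borel" using \<open>open (G n)\<close> by simp
    ultimately have "(\<lambda>\<omega>. (z n \<omega>, z (Suc n) \<omega>)) -` G n \<inter> space P \<in> sets P" by (rule measurable_sets)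
    then show ?thesis by (simp add: vimage_def Int_def conj_commute)
  qed
  then have "{\<omega> \<in> space P. \<forall>n. (z n \<omega>, z (Suc n) \<omega>) \<in> G n} \<in> sets P"
    by (rule sets.sets_Collect_countable_All)
  moreover have "(\<forall>t\<ge>s. interpolate a (\<lambda>n. z n \<omega>) t \<in> U) \<longleftrightarrow> (\<forall>n. (z n \<omega>, z (Suc n) \<omega>) \<in> G n)" for \<omega>
  proof
    assume *: "\<forall>t\<ge>s. interpolate a (\<lambda>n. z n \<omega>) t \<in> U"
    show "\<forall>n. (z n \<omega>, z (Suc n) \<omega>) \<in> G n"
    proof
      fix n
      have "seg n t (z n \<omega>, z (Suc n) \<omega>) \<in> U" if "t \<in> {max s (sa_time a n)..sa_time a (Suc n)}" for t
        using * that interpolate_eq[of n t "\<lambda>n. z n \<omega>"] by (auto simp: seg_def)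
      then show "(z n \<omega>, z (Suc n) \<omega>) \<in> G n" by (simp add: G_def)
    qed
  next
    assume *: "\<forall>n. (z n \<omega>, z (Suc n) \<omega>) \<in> G n"
    show "\<forall>t\<ge>s. interpolate a (\<lambda>n. z n \<omega>) t \<in> U"
    proof (intro allI impI)
      fix t assume t: "s \<le> t"
      obtain n where n: "sa_time a n \<le> t" "t < sa_time a (Suc n)"
        using sa_time_bracket[of t] t \<open>0 \<le> s\<close> by auto
      then have "t \<in> {max s (sa_time a n)..sa_time a (Suc n)}" using t by simp
      then have "seg n t (z n \<omega>, z (Suc n) \<omega>) \<in> U" using *[rule_format, of n] unfolding G_def by blast
      then show "interpolate a (\<lambda>n. z n \<omega>) t \<in> U"
        using n interpolate_eq[of n t "\<lambda>n. z n \<omega>"] by (simp add: seg_def)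
    qed
  qed
  ultimately show ?thesis by simp
qed

section \<open>Descent of the Lyapunov function\<close>

locale lyapunov_flow =
  fixes h :: "'v::euclidean_space \<Rightarrow> 'v" and V :: "'v \<Rightarrow> real" and gradV :: "'v \<Rightarrow> 'v"
    and B :: "'v set" and L T \<epsilon> \<Delta> :: real
  assumes lip: "L-lipschitz_on UNIV h"
    and V_grad: "\<And>z. GDERIV V z :> gradV z"
    and V_coercive: "filterlim V at_top at_infinity"
    and V_descent: "\<And>z. gradV z \<bullet> h z \<le> 0"
    and B: "bounded B" "open B" "sublevel V \<epsilon> \<subseteq> B"
    and T_pos: "0 < T" and \<Delta>_pos: "0 < \<Delta>"
    and descent: "\<And>y s. s > T \<Longrightarrow> solves_ode_on h y {0..s} \<Longrightarrow> y 0 \<in> closure B - sublevel V \<epsilon> \<Longrightarrow>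
             V (y s) < V (y 0) - \<Delta>"
begin

lemma V_cont: "continuous_on A V"
proof -
  have "isCont V z" for z
    using V_grad[of z] unfolding gderiv_def by (rule has_derivative_continuous)
  then show ?thesis by (simp add: continuous_at_imp_continuous_on)
qed

lemma V_le_Sup: "z \<in> closure B \<Longrightarrow> V z \<le> (SUP z\<in>closure B. V z)"
proof (rule cSUP_upper)
  have "compact (V ` closure B)"
    using B(1) by (intro compact_continuous_image V_cont) (simp add: compact_eq_bounded_closed bounded_closure)
  then show "bdd_above (V ` closure B)"
    by (intro bounded_imp_bdd_above compact_imp_bounded)
qed

text \<open>
  Otherwise the closure of \<open>B\<close> would lie in a sublevel set contained in \<open>B\<close>, and \<open>B\<close> would be clopen
  and bounded. The inequality makes the waiting time \<open>\<gamma>\<close> nonnegative.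
\<close>
lemma \<epsilon>_le_Sup:
  assumes "B \<noteq> {}"
  shows "\<epsilon> \<le> (SUP z\<in>closure B. V z)"
proof (rule ccontr)
  assume "\<not> ?thesis"
  then have "closure B \<subseteq> sublevel V \<epsilon>"
    using V_le_Sup by (force simp: sublevel_def)
  then have "closure B \<subseteq> B" using B(3) by blast
  then have "closed B" using closure_subset_eq by blast
  then have "B = UNIV" using B(2) clopen[of B] assms by blast
  then show False using B(1) not_bounded_UNIV by blast
qed

text \<open>
  Solutions from \<open>B\<close> stay in one sublevel set of \<open>V\<close>, which is bounded because \<open>V\<close> is coercive.
\<close>
lemma solutions_bounded:
  "\<exists>r\<ge>0. \<exists>C\<ge>0. \<forall>y S t. solves_ode_on h y {0..S} \<longrightarrow> y 0 \<in> B \<longrightarrow> t \<in> {0..S} \<longrightarrow>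
     norm (y t) \<le> r \<and> norm (h (y t)) \<le> C"
proof -
  define Vm where "Vm = (SUP z\<in>closure B. V z)"
  have "eventually (\<lambda>z. Vm + 1 \<le> V z) at_infinity"
    using V_coercive by (simp add: filterlim_at_top)
  then obtain r0 where r0: "\<And>z. r0 \<le> norm z \<Longrightarrow> Vm + 1 \<le> V z"
    unfolding eventually_at_infinity by blast
  define r where "r = max 0 r0"
  have "continuous_on (cball 0 r) h"
    using lip lipschitz_on_continuous_on continuous_on_subset by blast
  then have "bounded (h ` cball 0 r)"
    by (intro compact_imp_bounded compact_continuous_image compact_cball)
  then obtain C where C: "\<And>z. z \<in> cball 0 r \<Longrightarrow> norm (h z) \<le> C"
    unfolding bounded_iff by blast
  have "0 \<le> C" using C[of 0] by (auto simp: r_def intro: order_trans[OF norm_ge_zero])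
  moreover have "norm (y t) \<le> r \<and> norm (h (y t)) \<le> C"
    if y: "solves_ode_on h y {0..S}" "y 0 \<in> B" "t \<in> {0..S}" for y S t
  proof -
    have "V (y t) \<le> V (y 0)"
      using lyapunov_nonincreasing[OF V_grad V_descent y(1)] y(3) by simp
    also have "\<dots> \<le> Vm" unfolding Vm_def using y(2) closure_subset by (intro V_le_Sup) blast
    finally have "\<not> r0 \<le> norm (y t)" using r0[of "y t"] by fastforce
    then have "norm (y t) \<le> r" by (simp add: r_def)
    then show ?thesis using C by simp
  qed
  moreover have "0 \<le> r" by (simp add: r_def)
  ultimately show ?thesis by blast
qed

text \<open>
  Descent is assumed after times strictly greater than \<open>T\<close>, but a block may last exactly \<open>T\<close>. The
  non-strict inequality follows by continuity from the right, for which the solution has to exist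
  beyond the block.
\<close>
lemma descent_over_block:
  assumes y: "solves_ode_on h y {0..S}" "y 0 \<in> B" "\<epsilon> \<le> V (y 0)" and s: "T \<le> s" "s < S"
  shows "V (y s) \<le> V (y 0) - \<Delta>"
proof -
  have "continuous_on {0..S} (\<lambda>t. V (y t))"
    by (rule continuous_on_compose2[OF V_cont solves_ode_on_continuous[OF y(1)]]) auto
  then have "isCont (\<lambda>t. V (y t)) s"
    using s T_pos by (intro continuous_on_interior) (auto simp: interior_atLeastAtMost_real)
  then have "((\<lambda>t. V (y t)) \<longlongrightarrow> V (y s)) (at_right s)"
    by (simp add: isCont_def filterlim_at_split)
  moreover have "eventually (\<lambda>t. V (y t) \<le> V (y 0) - \<Delta>) (at_right s)"
    using eventually_at_right_less[of s] eventually_at_right_real[OF s(2)]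
  proof eventually_elim
    case (elim t)
    have "solves_ode_on h y {0..t}" using elim by (intro solves_ode_on_subset[OF y(1)]) auto
    then show ?case
      using descent[of t y] y(2,3) elim s closure_subset[of B] by (force simp: sublevel_def)
  qed
  ultimately show ?thesis by (rule tendsto_upperbound) simp
qed

end

locale lyapunov_scheme = divergent_steps a + lyapunov_flow h V gradV B L T \<epsilon> \<Delta>
  for a :: "nat \<Rightarrow> real" and h :: "'v::euclidean_space \<Rightarrow> 'v" and V gradV B L T \<epsilon> \<Delta>
begin

text \<open>
  The solution is taken on \<open>[0, T + 2]\<close> although blocks last at most \<open>T + 1\<close>, to leave room for the
  limit from the right in \<open>descent_over_block\<close>.
\<close>
definition tracks :: "(nat \<Rightarrow> 'v) \<Rightarrow> nat \<Rightarrow> nat \<Rightarrow> real \<Rightarrow> bool" where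
  "tracks z n n' \<mu> \<longleftrightarrow> (\<exists>y. solves_ode_on h y {0..T + 2} \<and> y 0 = z n \<and>
     (\<forall>t\<in>{sa_time a n..sa_time a n'}. norm (interpolate a z t - y (t - sa_time a n)) \<le> \<mu>))"

text \<open>
  The thresholds \<open>\<eta>\<close>, \<open>\<alpha>\<close> and \<open>r\<close> serve all paths and all blocks. The bound by \<open>r\<close> uses the noise only up to
  the time considered, so it can be applied before the noise is known to stay small in the whole block.
\<close>
lemma small_noise_tracks:
  assumes "0 < \<mu>"
  shows "\<exists>\<eta>>0. \<exists>\<alpha>>0. \<exists>r\<ge>0. \<forall>z \<nu> n N.
    (\<forall>m. z (Suc m) = z m + a m *\<^sub>R (h (z m) + \<nu> (Suc m))) \<longrightarrow> z n \<in> B \<longrightarrow> (\<forall>m\<ge>n. a m \<le> \<alpha>) \<longrightarrow>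
    sa_time a (n + N) \<le> sa_time a n + (T + 1) \<longrightarrow> 0 < N \<longrightarrow>
    (\<forall>j<N. (\<forall>i\<le>j. norm (\<Sum>k<i. a (n + k) *\<^sub>R \<nu> (n + k + 1)) \<le> \<eta>) \<longrightarrow> norm (z (n + j)) \<le> r) \<and>
    ((\<forall>i\<le>N. norm (\<Sum>k<i. a (n + k) *\<^sub>R \<nu> (n + k + 1)) \<le> \<eta>) \<longrightarrow> tracks z n (n + N) \<mu>)"
proof -
  define S where "S = T + 2"
  have S: "0 \<le> S" using T_pos by (simp add: S_def)
  have L0: "0 \<le> L" using lip by (rule lipschitz_on_nonneg)
  obtain r0 C where r0: "0 \<le> r0" and C0: "0 \<le> C"
    and bdd: "\<And>y S t. solves_ode_on h y {0..S} \<Longrightarrow> y 0 \<in> B \<Longrightarrow> t \<in> {0..S} \<Longrightarrow> norm (y t) \<le> r0 \<and> norm (h (y t)) \<le> C"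
    using solutions_bounded by blast
  \<comment> \<open>The noise and the discretization each get half of the error budget \<open>\<mu>\<close>.\<close>
  define e where "e = exp (L * S)"
  define \<eta> where "\<eta> = \<mu> / (2 * e)"
  \<comment> \<open>The summand 1 keeps \<open>D\<close> positive when \<open>C = 0\<close>.\<close>
  define D where "D = L * C * S * e + C + 1"
  define \<alpha> where "\<alpha> = \<mu> / (2 * D)"
  have e: "0 < e" by (simp add: e_def)
  have D: "0 < D" using L0 C0 S e by (simp add: D_def add_nonneg_pos)
  have \<eta>: "0 < \<eta>" and \<alpha>: "0 < \<alpha>" using \<open>0 < \<mu>\<close> e D by (simp_all add: \<eta>_def \<alpha>_def)
  have budget: "(\<eta> + L * C * S * \<alpha>) * exp (L * S) + C * \<alpha> \<le> \<mu>"
  proof -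
    have "(\<eta> + L * C * S * \<alpha>) * exp (L * S) + C * \<alpha> = \<eta> * e + (D - 1) * \<alpha>"
      by (simp add: e_def D_def algebra_simps)
    also have "\<dots> \<le> \<eta> * e + D * \<alpha>" using \<alpha> by simp
    also have "\<dots> = \<mu>" using e D by (simp add: \<eta>_def \<alpha>_def)
    finally show ?thesis .
  qed
  then have budget': "(\<eta> + L * C * S * \<alpha>) * exp (L * S) \<le> \<mu>"
    using C0 \<alpha> by (smt (verit) mult_nonneg_nonneg)
  have main: "(\<forall>j<N. (\<forall>i\<le>j. norm (\<Sum>k<i. a (n + k) *\<^sub>R \<nu> (n + k + 1)) \<le> \<eta>) \<longrightarrow> norm (z (n + j)) \<le> r0 + \<mu>) \<and>
    ((\<forall>i\<le>N. norm (\<Sum>k<i. a (n + k) *\<^sub>R \<nu> (n + k + 1)) \<le> \<eta>) \<longrightarrow> tracks z n (n + N) \<mu>)"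
    if rec: "\<forall>m. z (Suc m) = z m + a m *\<^sub>R (h (z m) + \<nu> (Suc m))" and zB: "z n \<in> B"
      and a_small: "\<forall>m\<ge>n. a m \<le> \<alpha>" and len: "sa_time a (n + N) \<le> sa_time a n + (T + 1)"
      and "0 < N" for z \<nu> n N
  proof -
    obtain y where y: "solves_ode_on h y {0..S}" "y 0 = z n"
      using ode_solution_exists[OF lip S] by blast
    have hC: "norm (h (y t)) \<le> C" and yr: "norm (y t) \<le> r0" if "t \<in> {0..S}" for t
      using bdd[OF y(1) _ that] y(2) zB by auto
    have len': "sa_time a (n + j) \<le> sa_time a n + S" if "j \<le> N" for j
      using len that sa_time_le_iff[of "n + j" "n + N"] by (simp add: S_def del: sa_time_le_iff)
    have "norm (z (n + j)) \<le> r0 + \<mu>"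
      if j: "j < N" and noise: "\<forall>i\<le>j. norm (\<Sum>k<i. a (n + k) *\<^sub>R \<nu> (n + k + 1)) \<le> \<eta>" for j
    proof -
      define \<tau> where "\<tau> = sa_time a (n + j) - sa_time a n"
      have "\<tau> \<in> {0..S}" using len'[of j] j by (simp add: \<tau>_def)
      have "norm (z (n + j) - y \<tau>) \<le> (\<eta> + L * C * S * \<alpha>) * exp (L * S)"
        unfolding \<tau>_def using lip y hC rec a_small noise len'[of j] j
        by (intro grid_tracking[where \<nu> = \<nu> and j = j]) auto
      then have "norm (z (n + j) - y \<tau>) \<le> \<mu>" using budget' by linarith
      then show ?thesis
        using yr[OF \<open>\<tau> \<in> {0..S}\<close>] norm_triangle_sub[of "z (n + j)" "y \<tau>"] by linarith
    qed
    moreover have "tracks z n (n + N) \<mu>"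
      if noise: "\<forall>i\<le>N. norm (\<Sum>k<i. a (n + k) *\<^sub>R \<nu> (n + k + 1)) \<le> \<eta>"
    proof -
      have "norm (interpolate a z t - y (t - sa_time a n)) \<le> \<mu>"
        if "t \<in> {sa_time a n..sa_time a (n + N)}" for t
        using budget that lip y hC rec a_small noise len'[of N] \<open>0 < N\<close>
        by (intro order_trans[OF interpolated_tracking[where \<nu> = \<nu> and h = h and L = L and S = S
              and C = C and \<alpha> = \<alpha> and \<eta> = \<eta> and j = N] budget]) auto
      then show ?thesis using y unfolding tracks_def S_def by blast
    qed
    ultimately show ?thesis by blast
  qed
  moreover have "0 \<le> r0 + \<mu>" using r0 \<open>0 < \<mu>\<close> by simp
  ultimately show ?thesis using \<eta> \<alpha> by blast
qed

text \<open>
  As long as \<open>V \<ge> \<epsilon>\<close> at the start of a block, the solution loses at least \<open>\<Delta>\<close> and the tracking error gives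
  back less than \<open>\<Delta> / 2\<close>. So after at most \<open>(sup V - \<epsilon>) / (\<Delta> / 2)\<close> blocks, each of length at most \<open>T + 1\<close>,
  some block starts with \<open>V < \<epsilon> + \<Delta> / 2\<close>. This level is then never exceeded at later block starts: from
  \<open>[\<epsilon>, \<epsilon> + \<Delta> / 2)\<close> the value decreases, and from below \<open>\<epsilon>\<close> it rises by less than \<open>\<Delta> / 2\<close>. Inside the
  blocks the path is \<open>\<mu>\<close>-close to solutions that remain in the sublevel set.
\<close>
lemma tracking_implies_confinement:
  fixes z :: "nat \<Rightarrow> 'v" and n0 :: nat
  defines "ns \<equiv> block_start a T n0"
  assumes z0: "z n0 \<in> B"
    and stay: "\<And>i. z (ns i) \<in> B \<Longrightarrow> block_error a T h z n0 i < \<delta>B \<Longrightarrow> z (ns (Suc i)) \<in> B"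
    and track: "\<And>i. z (ns i) \<in> B \<Longrightarrow> tracks z (ns i) (ns (Suc i)) \<mu>"
    and \<mu>: "\<mu> < \<delta>B" "\<mu> < \<delta>"
    and V_near: "\<And>y t w. solves_ode_on h y {0..T + 2} \<Longrightarrow> y 0 \<in> B \<Longrightarrow> t \<in> {0..T + 2} \<Longrightarrow>
        norm (w - y t) \<le> \<mu> \<Longrightarrow> \<bar>V w - V (y t)\<bar> < \<Delta> / 2"
    and steps: "\<And>m. n0 \<le> m \<Longrightarrow> a m \<le> 1"
    and t: "sa_time a n0 + ((SUP z\<in>closure B. V z) - \<epsilon>) / (\<Delta> / 2) * (T + 1) \<le> t"
  shows "interpolate a z t \<in> nbhd \<delta> (sublevel V (\<epsilon> + \<Delta> / 2))"
proof -
  define Vm where "Vm = (SUP z\<in>closure B. V z)"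
  define \<tau> where "\<tau> i = sa_time a (ns i)" for i
  note ns_step = block_start_step[OF T_pos, of n0, folded ns_def]
  have ns_ge: "n0 + i \<le> ns i" for i using block_start_ge[OF T_pos] by (simp add: ns_def)
  have len: "T \<le> \<tau> (Suc i) - \<tau> i" "\<tau> (Suc i) - \<tau> i \<le> T + 1" for i
  proof -
    have "n0 \<le> ns (Suc i) - 1" using ns_ge[of "Suc i"] by simp
    then show "T \<le> \<tau> (Suc i) - \<tau> i" "\<tau> (Suc i) - \<tau> i \<le> T + 1"
      using ns_step(1,3)[of i] steps[of "ns (Suc i) - 1"] by (auto simp: \<tau>_def)
  qed
  have in_B: "z (ns i) \<in> B" for i
  proof (induction i)
    case 0
    show ?case using z0 by (simp add: ns_def)
  next
    case (Suc i)
    obtain y where y: "solves_ode_on h y {0..T + 2}" "y 0 = z (ns i)"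
      and close: "\<And>t. t \<in> {\<tau> i..\<tau> (Suc i)} \<Longrightarrow> norm (interpolate a z t - y (t - \<tau> i)) \<le> \<mu>"
      using track[OF Suc] unfolding tracks_def \<tau>_def by blast
    have "block_error a T h z n0 i \<le> \<mu>"
      unfolding block_error_def Let_def ns_def[symmetric] \<tau>_def[symmetric]
    proof (rule cSUP_least)
      show "{\<tau> i..<\<tau> (Suc i)} \<noteq> {}" using len[of i] T_pos by simp
      fix t assume t: "t \<in> {\<tau> i..<\<tau> (Suc i)}"
      have "ode_value h (\<tau> i) (z (ns i)) t = y (t - \<tau> i)"
        using ode_value_eq[OF lip y(1), of "\<tau> i" t] t len[of i] y(2) by simp
      then show "norm (interpolate a z t - ode_value h (\<tau> i) (z (ns i)) t) \<le> \<mu>"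
        using close[of t] t by simp
    qed
    then show ?case using stay[OF Suc] \<mu> by linarith
  qed
  have block: "\<exists>y. solves_ode_on h y {0..T + 2} \<and> y 0 = z (ns i) \<and>
      (\<forall>t\<in>{\<tau> i..\<tau> (Suc i)}. norm (interpolate a z t - y (t - \<tau> i)) \<le> \<mu>)" for i
    using track[OF in_B] unfolding tracks_def \<tau>_def by blast
  have next_V: "(\<epsilon> \<le> V (z (ns i)) \<longrightarrow> V (z (ns (Suc i))) < V (z (ns i)) - \<Delta> / 2) \<and>
      V (z (ns (Suc i))) < V (z (ns i)) + \<Delta> / 2" for i
  proof -
    obtain y where y: "solves_ode_on h y {0..T + 2}" "y 0 = z (ns i)"
      and close: "\<forall>t\<in>{\<tau> i..\<tau> (Suc i)}. norm (interpolate a z t - y (t - \<tau> i)) \<le> \<mu>"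
      using block by blast
    define s where "s = \<tau> (Suc i) - \<tau> i"
    have s: "T \<le> s" "s \<le> T + 1" using len by (simp_all add: s_def)
    have "interpolate a z (\<tau> (Suc i)) = z (ns (Suc i))"
      using interpolate_eq[of "ns (Suc i)" "\<tau> (Suc i)" z] by (simp add: \<tau>_def)
    then have "norm (z (ns (Suc i)) - y s) \<le> \<mu>"
      using close len[of i] T_pos by (auto simp: s_def dest: bspec[of _ _ "\<tau> (Suc i)"])
    then have "\<bar>V (z (ns (Suc i))) - V (y s)\<bar> < \<Delta> / 2"
      using V_near[OF y(1), of s] in_B[of i] y(2) s T_pos by simp
    then have near: "V (z (ns (Suc i))) < V (y s) + \<Delta> / 2" by linarith
    have "V (y s) \<le> V (z (ns i))"
      using lyapunov_nonincreasing[OF V_grad V_descent y(1), of s] s T_pos y(2) by simp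
    moreover have "V (y s) \<le> V (z (ns i)) - \<Delta>" if "\<epsilon> \<le> V (z (ns i))"
      using descent_over_block[OF y(1), of s] that in_B[of i] y(2) s by simp
    ultimately show ?thesis using near by auto
  qed
  have absorb: "V (z (ns (i + k))) < \<epsilon> + \<Delta> / 2" if "V (z (ns i)) < \<epsilon> + \<Delta> / 2" for i k
    using that
  proof (induction k)
    case (Suc k)
    then have "V (z (ns (i + k))) < \<epsilon> + \<Delta> / 2" by simp
    then show ?case
      using next_V[of "i + k"] \<Delta>_pos by (cases "\<epsilon> \<le> V (z (ns (i + k)))") auto
  qed simp
  have V0: "V (z n0) \<le> Vm"
    unfolding Vm_def using z0 closure_subset by (intro V_le_Sup) blast
  have \<tau>_le: "\<tau> i \<le> sa_time a n0 + i * (T + 1)" for i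
  proof (induction i)
    case (Suc i)
    then show ?case using len(2)[of i] by (simp add: algebra_simps)
  qed (simp add: \<tau>_def ns_def)
  have decrease: "V (z (ns i)) \<le> Vm - i * (\<Delta> / 2)"
    if "\<And>k. k < i \<Longrightarrow> \<epsilon> + \<Delta> / 2 \<le> V (z (ns k))" for i
    using that
  proof (induction i)
    case (Suc i)
    then have "V (z (ns i)) \<le> Vm - i * (\<Delta> / 2)" by simp
    moreover have "V (z (ns (Suc i))) < V (z (ns i)) - \<Delta> / 2"
      using next_V[of i] Suc.prems[of i] \<Delta>_pos by auto
    ultimately show ?case by (simp add: algebra_simps add_divide_distrib)
  qed (use V0 in \<open>simp add: ns_def\<close>)
  have "\<exists>i. V (z (ns i)) < \<epsilon> + \<Delta> / 2"
  proof (rule ccontr)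
    assume "\<nexists>i. V (z (ns i)) < \<epsilon> + \<Delta> / 2"
    then have ge: "\<epsilon> + \<Delta> / 2 \<le> V (z (ns i))" for i by (simp add: not_less)
    obtain i :: nat where "(Vm - \<epsilon>) / (\<Delta> / 2) < i" using reals_Archimedean2 by blast
    then have "Vm - i * (\<Delta> / 2) < \<epsilon>" using \<Delta>_pos by (simp add: field_simps)
    then show False using ge[of i] decrease[of i] ge \<Delta>_pos by fastforce
  qed
  define i0 where "i0 = (LEAST i. V (z (ns i)) < \<epsilon> + \<Delta> / 2)"
  have i0: "V (z (ns i0)) < \<epsilon> + \<Delta> / 2"
    unfolding i0_def by (rule LeastI_ex) fact
  have before: "\<epsilon> + \<Delta> / 2 \<le> V (z (ns k))" if "k < i0" for k
    using not_less_Least[of k "\<lambda>i. V (z (ns i)) < \<epsilon> + \<Delta> / 2"] that by (simp add: i0_def not_less)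
  \<comment> \<open>The block before \<open>i0\<close> still starts at level at least \<open>\<epsilon> + \<Delta> / 2\<close>; this extra \<open>\<Delta> / 2\<close> pays for the last block.\<close>
  have "real i0 \<le> (Vm - \<epsilon>) / (\<Delta> / 2)"
  proof (cases i0)
    case 0
    have "\<epsilon> \<le> Vm" unfolding Vm_def using z0 by (intro \<epsilon>_le_Sup) auto
    then show ?thesis using 0 \<Delta>_pos by simp
  next
    case (Suc j)
    have "\<epsilon> + \<Delta> / 2 \<le> Vm - j * (\<Delta> / 2)"
      using before[of j] decrease[of j] before Suc by force
    then have "real i0 * (\<Delta> / 2) \<le> Vm - \<epsilon>" using Suc by (simp add: algebra_simps add_divide_distrib)
    then show ?thesis using \<Delta>_pos by (subst pos_le_divide_eq) auto
  qed
  then have "real i0 * (T + 1) \<le> (Vm - \<epsilon>) / (\<Delta> / 2) * (T + 1)"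
    using T_pos by (intro mult_right_mono) auto
  then have reached: "\<tau> i0 \<le> t" using \<tau>_le[of i0] t by (simp add: Vm_def)
  have "\<exists>i. t < \<tau> i"
  proof -
    obtain m where m: "t + 1 \<le> sa_time a m" using sa_time_unbounded by blast
    have "sa_time a m \<le> \<tau> m" using ns_ge[of m] by (simp add: \<tau>_def)
    then show ?thesis using m by (intro exI[of _ m]) linarith
  qed
  then have late: "t < \<tau> (LEAST i. t < \<tau> i)" by (rule LeastI_ex)
  define k where "k = (LEAST i. t < \<tau> i)"
  have ns_mono: "strict_mono ns" unfolding ns_def using T_pos by (rule block_start_strict_mono)
  have "\<tau> i0 < \<tau> k" using late reached unfolding k_def by linarith
  then have "i0 < k" using ns_mono by (simp add: \<tau>_def strict_mono_less)
  then obtain i where i: "k = Suc i" "i0 \<le> i" by (cases k) auto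
  have "\<tau> i \<le> t" using not_less_Least[of i "\<lambda>i. t < \<tau> i"] i(1) by (simp add: k_def not_less)
  obtain y where y: "solves_ode_on h y {0..T + 2}" "y 0 = z (ns i)"
    and close: "\<forall>t\<in>{\<tau> i..\<tau> (Suc i)}. norm (interpolate a z t - y (t - \<tau> i)) \<le> \<mu>"
    using block by blast
  have ti: "t \<in> {\<tau> i..\<tau> (Suc i)}" using \<open>\<tau> i \<le> t\<close> late i(1) by (simp add: k_def)
  have "V (y (t - \<tau> i)) \<le> V (z (ns i))"
    using lyapunov_nonincreasing[OF V_grad V_descent y(1), of "t - \<tau> i"] ti len[of i] y(2) by simp
  also have "\<dots> < \<epsilon> + \<Delta> / 2" using absorb[OF i0, of "i - i0"] i(2) by simp
  finally have "y (t - \<tau> i) \<in> sublevel V (\<epsilon> + \<Delta> / 2)" by (simp add: sublevel_def)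
  moreover have "norm (interpolate a z t - y (t - \<tau> i)) \<le> \<mu>" using close ti by blast
  then have "interpolate a z t \<in> ball (y (t - \<tau> i)) \<delta>"
    using \<mu> by (simp add: dist_norm norm_minus_commute)
  ultimately show ?thesis unfolding nbhd_def by blast
qed

text \<open>
  Solutions from \<open>B\<close> stay in a fixed ball, and \<open>V\<close> is uniformly continuous on a slightly larger one.
\<close>
lemma V_uniformly_near_solutions:
  assumes "0 < e"
  shows "\<exists>\<mu>>0. \<forall>y S t w. solves_ode_on h y {0..S} \<longrightarrow> y 0 \<in> B \<longrightarrow> t \<in> {0..S} \<longrightarrow>
    norm (w - y t) \<le> \<mu> \<longrightarrow> \<bar>V w - V (y t)\<bar> < e"
proof -
  obtain r C where bdd: "\<And>y S t. solves_ode_on h y {0..S} \<Longrightarrow> y 0 \<in> B \<Longrightarrow> t \<in> {0..S} \<Longrightarrow>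
      norm (y t) \<le> r \<and> norm (h (y t)) \<le> C"
    using solutions_bounded by blast
  have "uniformly_continuous_on (cball 0 (r + 1)) V"
    by (intro compact_uniformly_continuous V_cont compact_cball)
  then obtain d where d: "0 < d"
    "\<And>v w. v \<in> cball 0 (r + 1) \<Longrightarrow> w \<in> cball 0 (r + 1) \<Longrightarrow> dist w v < d \<Longrightarrow> dist (V w) (V v) < e"
    unfolding uniformly_continuous_on_def using \<open>0 < e\<close> by blast
  define \<mu> where "\<mu> = min 1 (d / 2)"
  have "\<bar>V w - V (y t)\<bar> < e" if y: "solves_ode_on h y {0..S}" "y 0 \<in> B" "t \<in> {0..S}"
    and w: "norm (w - y t) \<le> \<mu>" for y S t w
  proof -
    have "norm (y t) \<le> r" using bdd[OF y] by simp
    moreover have "norm w \<le> norm (y t) + 1"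
      using w norm_triangle_sub[of w "y t"] by (simp add: \<mu>_def)
    ultimately have "dist (V w) (V (y t)) < e"
      using w d(1) by (intro d(2)) (auto simp: \<mu>_def dist_norm)
    then show ?thesis by (simp add: dist_real_def)
  qed
  moreover have "0 < \<mu>" using d(1) by (simp add: \<mu>_def)
  ultimately show ?thesis by blast
qed

end

section \<open>Sums over blocks\<close>

text \<open>
  Half of the exponent makes the series converge, by \<open>exp (- s) \<le> 2 / s\<^sup>2\<close> with \<open>s\<close> of order
  \<open>1 / sqrt (\<beta> i)\<close>, so that the terms are at most a multiple of \<open>\<beta> i\<close>. The other half survives as a common
  factor, and \<open>sqrt (\<beta> i) \<le> sqrt b \<le> root 4 b\<close> since \<open>b \<le> 1\<close>.
\<close>
lemma sum_exp_le_exp_fourth_root: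
  fixes \<beta> :: "nat \<Rightarrow> real"
  assumes c: "0 < c" and \<beta>: "\<And>i. 0 < \<beta> i" and part: "\<And>k. (\<Sum>i<k. \<beta> i) \<le> b" and "b \<le> 1"
  shows "summable (\<lambda>i. exp (- (c / sqrt (\<beta> i))))"
    and "(\<Sum>i. exp (- (c / sqrt (\<beta> i)))) \<le> 8 / c\<^sup>2 * exp (- (c / 2 / root 4 b))"
proof -
  have \<beta>b: "\<beta> i \<le> b" for i
  proof -
    have "\<beta> i \<le> (\<Sum>i<Suc i. \<beta> i)" using \<beta> by (intro member_le_sum) (auto simp: less_imp_le)
    then show ?thesis using part[of "Suc i"] by linarith
  qed
  then have b: "0 < b" using \<beta>[of 0] by (meson less_le_trans)
  have le: "exp (- (c / sqrt (\<beta> i))) \<le> 8 / c\<^sup>2 * exp (- (c / 2 / root 4 b)) * \<beta> i" for i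
  proof -
    define s where "s = c / 2 / sqrt (\<beta> i)"
    have s: "0 < s" using c \<beta>[of i] by (simp add: s_def)
    have "exp (- s) \<le> 2 / s\<^sup>2"
    proof -
      have "s\<^sup>2 \<le> 2 * exp s" using s by (intro square_le_exp) simp
      then show ?thesis using s by (simp add: exp_minus field_simps)
    qed
    also have "2 / s\<^sup>2 = 8 / c\<^sup>2 * \<beta> i"
      using c \<beta>[of i] by (simp add: s_def power_divide)
    finally have 1: "exp (- s) \<le> 8 / c\<^sup>2 * \<beta> i" .
    have "sqrt (\<beta> i) \<le> root 4 b"
    proof -
      have "sqrt (\<beta> i) \<le> sqrt b" using \<beta>b by simp
      also have "\<dots> = root 4 (b\<^sup>2)"
      proof -
        have "root 4 (b\<^sup>2) = root 2 (root 2 (b\<^sup>2))" using real_root_mult_exp[of 2 2 "b\<^sup>2"] by simp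
        then show ?thesis using b by (simp add: sqrt_def[symmetric])
      qed
      also have "\<dots> \<le> root 4 b"
        using b \<open>b \<le> 1\<close> by (simp add: power2_eq_square mult_left_le)
      finally show ?thesis .
    qed
    then have "c / 2 / root 4 b \<le> s"
      unfolding s_def using c \<beta>[of i] b by (intro divide_left_mono mult_pos_pos) auto
    then have 2: "exp (- s) \<le> exp (- (c / 2 / root 4 b))" by simp
    have "exp (- (c / sqrt (\<beta> i))) = exp (- s) * exp (- s)"
      by (simp add: s_def mult_exp_exp)
    also have "\<dots> \<le> (8 / c\<^sup>2 * \<beta> i) * exp (- (c / 2 / root 4 b))"
      using 1 2 \<beta>[of i] by (intro mult_mono) (auto simp: less_imp_le)
    finally show ?thesis by (simp add: mult_ac)
  qed
  define D where "D = 8 / c\<^sup>2 * exp (- (c / 2 / root 4 b))"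
  have D: "0 \<le> D" by (simp add: D_def)
  have sum_le: "(\<Sum>i<k. exp (- (c / sqrt (\<beta> i)))) \<le> D" for k
  proof -
    have "(\<Sum>i<k. exp (- (c / sqrt (\<beta> i)))) \<le> (\<Sum>i<k. D * \<beta> i)"
      using le by (intro sum_mono) (simp add: D_def)
    also have "\<dots> = D * (\<Sum>i<k. \<beta> i)" by (simp add: sum_distrib_left)
    also have "\<dots> \<le> D * 1"
      using part[of k] \<open>b \<le> 1\<close> D by (intro mult_left_mono) auto
    finally show ?thesis by simp
  qed
  show "summable (\<lambda>i. exp (- (c / sqrt (\<beta> i))))"
    by (rule summableI_nonneg_bounded[where x = D]) (use sum_le in auto)
  then show "(\<Sum>i. exp (- (c / sqrt (\<beta> i)))) \<le> 8 / c\<^sup>2 * exp (- (c / 2 / root 4 b))"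
    using sum_le unfolding D_def[symmetric] by (rule suminf_le_const)
qed

lemma sum_shift_lessThan:
  fixes f :: "nat \<Rightarrow> real"
  shows "(\<Sum>l<q - p. f (p + l)) = sum f {p..<q}"
  by (rule sum.reindex_bij_witness[of _ "\<lambda>m. m - p" "\<lambda>l. p + l"]) auto

lemma sum_over_blocks:
  fixes f :: "nat \<Rightarrow> real" and ns :: "nat \<Rightarrow> nat"
  assumes "mono ns"
  shows "(\<Sum>i<k. \<Sum>l<ns (Suc i) - ns i. f (ns i + l)) = (\<Sum>l<ns k - ns 0. f (ns 0 + l))"
proof (induction k)
  case (Suc k)
  have "ns 0 \<le> ns k" "ns k \<le> ns (Suc k)" using assms by (auto simp: mono_def)
  then show ?case using Suc by (simp add: sum_shift_lessThan sum.atLeastLessThan_concat)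
qed simp

section \<open>Probability of confinement\<close>

locale lyapunov_approximation =
  noisy_recursion P a h x M C1 C2 + lyapunov_scheme a h V gradV B L T \<epsilon> \<Delta>
  for P :: "'w measure" and a and h :: "real ^ 'd \<Rightarrow> real ^ 'd"
    and x M :: "nat \<Rightarrow> 'w \<Rightarrow> real ^ 'd" and C1 C2 V gradV B L T \<epsilon> \<Delta> +
  assumes a_sq: "summable (\<lambda>n. (a n)\<^sup>2)"
begin

lemma eventually_step_le:
  assumes "0 < \<alpha>"
  shows "eventually (\<lambda>n0. \<forall>m\<ge>n0. a m \<le> \<alpha>) sequentially"
proof -
  have "(\<lambda>n. (a n)\<^sup>2) \<longlonglongrightarrow> 0" using a_sq by (rule summable_LIMSEQ_zero)
  then have "eventually (\<lambda>n. (a n)\<^sup>2 < \<alpha>\<^sup>2) sequentially"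
    using \<open>0 < \<alpha>\<close> order_tendstoD(2)[of _ 0 sequentially "\<alpha>\<^sup>2"] by simp
  then have "eventually (\<lambda>n. a n \<le> \<alpha>) sequentially"
    by eventually_elim (use \<open>0 < \<alpha>\<close> in \<open>auto intro: less_imp_le power2_less_imp_less\<close>)
  then show ?thesis unfolding eventually_sequentially by (meson order_trans)
qed

lemma eventually_tail_le_1: "eventually (\<lambda>n0. (\<Sum>m. (a (n0 + m))\<^sup>2) \<le> 1) sequentially"
proof -
  have "(\<lambda>n. \<Sum>k. (a (k + n))\<^sup>2) \<longlonglongrightarrow> 0"
    by (rule suminf_exist_split2[OF a_sq])
  then have "eventually (\<lambda>n. (\<Sum>k. (a (k + n))\<^sup>2) < 1) sequentially"
    by (intro order_tendstoD) auto
  then show ?thesis by eventually_elim (simp add: add.commute)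
qed

text \<open>
  If the path starts in \<open>B\<close> and is not confined, then in some block that starts in \<open>B\<close> the noise exceeds the
  threshold, since otherwise every block is tracked. The probabilities of these bad blocks, taken
  relative to the event \<open>x n0 \<in> B\<close>, are summed over the blocks.
\<close>
lemma failure_probability:
  assumes "0 < \<delta>" "0 < \<delta>B"
    and stay: "\<And>n0 i \<omega>. \<omega> \<in> space P \<Longrightarrow> x (block_start a T n0 i) \<omega> \<in> B \<Longrightarrow>
             block_error a T h (\<lambda>n. x n \<omega>) n0 i < \<delta>B \<Longrightarrow> x (block_start a T n0 (Suc i)) \<omega> \<in> B"
  defines "confined n0 \<omega> \<equiv> \<forall>t \<ge> sa_time a n0 + ((SUP z\<in>closure B. V z) - \<epsilon>) / (\<Delta> / 2) * (T + 1).
             interpolate a (\<lambda>n. x n \<omega>) t \<in> nbhd \<delta> (sublevel V (\<epsilon> + \<Delta> / 2))"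
  shows "\<exists>c1>0. \<exists>c>0. \<forall>\<^sub>F n0 in sequentially.
    prob {\<omega> \<in> space P. x n0 \<omega> \<in> B \<and> \<not> confined n0 \<omega>}
      \<le> c1 * exp (- (c / root 4 (\<Sum>m. (a (n0 + m))\<^sup>2))) * prob {\<omega> \<in> space P. x n0 \<omega> \<in> B}"
proof -
  obtain \<mu>0 where \<mu>0: "0 < \<mu>0"
    "\<And>y S t w. solves_ode_on h y {0..S} \<Longrightarrow> y 0 \<in> B \<Longrightarrow> t \<in> {0..S} \<Longrightarrow>
      norm (w - y t) \<le> \<mu>0 \<Longrightarrow> \<bar>V w - V (y t)\<bar> < \<Delta> / 2"
    using V_uniformly_near_solutions[of "\<Delta> / 2"] \<Delta>_pos by auto
  \<comment> \<open>Accuracy below \<open>\<delta>B\<close> keeps the block starts in \<open>B\<close>, and accuracy below \<open>\<delta>\<close> places the path in the neighborhood.\<close>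
  define \<mu> where "\<mu> = min \<mu>0 (min (\<delta> / 2) (\<delta>B / 2))"
  have \<mu>: "0 < \<mu>" "\<mu> \<le> \<mu>0" "\<mu> < \<delta>" "\<mu> < \<delta>B"
    using \<mu>0(1) \<open>0 < \<delta>\<close> \<open>0 < \<delta>B\<close> by (auto simp: \<mu>_def)
  obtain \<eta> \<alpha> r where \<eta>: "0 < \<eta>" and \<alpha>: "0 < \<alpha>" and r: "0 \<le> r" and track: "\<forall>z \<nu> n N.
    (\<forall>m. z (Suc m) = z m + a m *\<^sub>R (h (z m) + \<nu> (Suc m))) \<longrightarrow> z n \<in> B \<longrightarrow> (\<forall>m\<ge>n. a m \<le> \<alpha>) \<longrightarrow>
    sa_time a (n + N) \<le> sa_time a n + (T + 1) \<longrightarrow> 0 < N \<longrightarrow>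
    (\<forall>j<N. (\<forall>i\<le>j. norm (\<Sum>k<i. a (n + k) *\<^sub>R \<nu> (n + k + 1)) \<le> \<eta>) \<longrightarrow> norm (z (n + j)) \<le> r) \<and>
    ((\<forall>i\<le>N. norm (\<Sum>k<i. a (n + k) *\<^sub>R \<nu> (n + k + 1)) \<le> \<eta>) \<longrightarrow> tracks z n (n + N) \<mu>)"
    using small_noise_tracks[OF \<mu>(1)] by blast
  obtain K c where K: "0 < K" and c: "0 < c" and conc: "\<forall>n N A. A \<in> sets (F n) \<longrightarrow> 0 < N \<longrightarrow>
      (\<forall>\<omega>\<in>A. \<forall>j<N. (\<forall>i\<le>j. norm (noise_sum n i \<omega>) \<le> \<eta>) \<longrightarrow> norm (x (n + j) \<omega>) \<le> r) \<longrightarrow>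
      prob {\<omega> \<in> A. \<exists>i\<le>N. \<eta> < norm (noise_sum n i \<omega>)}
        \<le> K * exp (- (c / sqrt (\<Sum>k<N. (a (n + k))\<^sup>2))) * prob A"
    using block_concentration[OF r \<eta>] by blast
  have main: "prob {\<omega> \<in> space P. x n0 \<omega> \<in> B \<and> \<not> confined n0 \<omega>}
      \<le> (K * (8 / c\<^sup>2)) * exp (- (c / 2 / root 4 (\<Sum>m. (a (n0 + m))\<^sup>2))) * prob {\<omega> \<in> space P. x n0 \<omega> \<in> B}"
    if small: "\<forall>m\<ge>n0. a m \<le> \<alpha>" and small1: "\<forall>m\<ge>n0. a m \<le> 1" and b1: "(\<Sum>m. (a (n0 + m))\<^sup>2) \<le> 1" for n0
  proof -
    define b where "b = (\<Sum>m. (a (n0 + m))\<^sup>2)"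
    define ns where "ns = block_start a T n0"
    define N where "N i = ns (Suc i) - ns i" for i
    define A0 where "A0 = {\<omega> \<in> space P. x n0 \<omega> \<in> B}"
    define A where "A i = {\<omega> \<in> space P. x n0 \<omega> \<in> B \<and> x (ns i) \<omega> \<in> B}" for i
    define Bad where "Bad i = {\<omega> \<in> A i. \<exists>j\<le>N i. \<eta> < norm (noise_sum (ns i) j \<omega>)}" for i
    define \<beta> where "\<beta> i = (\<Sum>k<N i. (a (ns i + k))\<^sup>2)" for i
    have ns_0: "ns 0 = n0" by (simp add: ns_def)
    have ns_lt: "ns i < ns (Suc i)" for i using block_start_step(2)[OF T_pos] by (simp add: ns_def)
    have ns_ge: "n0 \<le> ns i" for i using block_start_ge[OF T_pos, of n0 i] by (simp add: ns_def)
    have N: "0 < N i" "ns i + N i = ns (Suc i)" for i using ns_lt[of i] by (simp_all add: N_def)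
    have len: "sa_time a (ns (Suc i)) \<le> sa_time a (ns i) + (T + 1)" for i
    proof -
      have "n0 \<le> ns (Suc i) - 1" using ns_ge[of i] ns_lt[of i] by linarith
      then show ?thesis
        using small1 block_start_step(3)[OF T_pos, of n0 i, folded ns_def] by fastforce
    qed
    have good: "(\<forall>j<N i. (\<forall>k\<le>j. norm (noise_sum (ns i) k \<omega>) \<le> \<eta>) \<longrightarrow> norm (x (ns i + j) \<omega>) \<le> r) \<and>
        ((\<forall>k\<le>N i. norm (noise_sum (ns i) k \<omega>) \<le> \<eta>) \<longrightarrow> tracks (\<lambda>n. x n \<omega>) (ns i) (ns (Suc i)) \<mu>)"
      if "\<omega> \<in> space P" "x (ns i) \<omega> \<in> B" for \<omega> i
      using track[rule_format, of "\<lambda>n. x n \<omega>" "\<lambda>n. M n \<omega>" "ns i" "N i"] that iterates small ns_ge[of i]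
        len[of i] N[of i] by (simp add: noise_sum_def)
    have A_F: "A i \<in> sets (F (ns i))" for i
    proof -
      have [measurable]: "x n0 \<in> borel_measurable (F (ns i))" "x (ns i) \<in> borel_measurable (F (ns i))"
        using ns_ge by (auto intro: x_F)
      have [measurable]: "B \<in> sets borel" using B(2) by simp
      have "{\<omega> \<in> space (F (ns i)). x n0 \<omega> \<in> B \<and> x (ns i) \<omega> \<in> B} \<in> sets (F (ns i))" by measurable
      then show ?thesis by (simp add: A_def)
    qed
    have A_P: "A i \<in> sets P" for i using A_F sets_F_subset by blast
    have A0_P: "A0 \<in> sets P" using A_P[of 0] by (simp add: A_def A0_def ns_0)
    have Bad_P: "Bad i \<in> sets P" for i
    proof -
      have [measurable]: "noise_sum (ns i) j \<in> borel_measurable P" for j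
        using noise_sum_F[OF order_refl] by (rule measurable_F_P)
      have [measurable]: "A i \<in> sets P" by (rule A_P)
      have "{\<omega> \<in> space P. \<omega> \<in> A i \<and> (\<exists>j\<in>{..N i}. \<eta> < norm (noise_sum (ns i) j \<omega>))} \<in> sets P" by measurable
      moreover have "A i \<subseteq> space P" by (auto simp: A_def)
      ultimately show ?thesis by (simp add: Bad_def Bex_def Int_absorb1 Collect_conj_eq subset_eq)
    qed
    have Bad_le: "prob (Bad i) \<le> K * exp (- (c / sqrt (\<beta> i))) * prob A0" for i
    proof -
      have "prob (Bad i) \<le> K * exp (- (c / sqrt (\<beta> i))) * prob (A i)"
        unfolding Bad_def \<beta>_def using good
        by (intro conc[rule_format, OF A_F N(1)]) (auto simp: A_def)
      also have "\<dots> \<le> K * exp (- (c / sqrt (\<beta> i))) * prob A0"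
        using K A0_P by (intro mult_left_mono finite_measure_mono) (auto simp: A_def A0_def)
      finally show ?thesis .
    qed
    have cover: "{\<omega> \<in> space P. x n0 \<omega> \<in> B \<and> \<not> confined n0 \<omega>} \<subseteq> (\<Union>i. Bad i)"
    proof (rule subsetI, rule ccontr)
      fix \<omega> assume \<omega>: "\<omega> \<in> {\<omega> \<in> space P. x n0 \<omega> \<in> B \<and> \<not> confined n0 \<omega>}" and "\<omega> \<notin> (\<Union>i. Bad i)"
      then have quiet: "norm (noise_sum (ns i) j \<omega>) \<le> \<eta>" if "x (ns i) \<omega> \<in> B" "j \<le> N i" for i j
        using that by (fastforce simp: Bad_def A_def not_less)
      have "confined n0 \<omega>"
        unfolding confined_def
      proof (intro allI impI)
        fix t assume t: "sa_time a n0 + ((SUP z\<in>closure B. V z) - \<epsilon>) / (\<Delta> / 2) * (T + 1) \<le> t"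
        show "interpolate a (\<lambda>n. x n \<omega>) t \<in> nbhd \<delta> (sublevel V (\<epsilon> + \<Delta> / 2))"
        proof (rule tracking_implies_confinement[OF _ _ _ \<mu>(4,3) _ _ t])
          show "x n0 \<omega> \<in> B" using \<omega> by simp
          show "x (block_start a T n0 (Suc i)) \<omega> \<in> B"
            if "x (block_start a T n0 i) \<omega> \<in> B" "block_error a T h (\<lambda>n. x n \<omega>) n0 i < \<delta>B" for i
            using stay that \<omega> by blast
          show "tracks (\<lambda>n. x n \<omega>) (block_start a T n0 i) (block_start a T n0 (Suc i)) \<mu>"
            if "x (block_start a T n0 i) \<omega> \<in> B" for i
            using good[of \<omega> i] quiet[of i] that \<omega> by (auto simp: ns_def)
          show "\<bar>V w - V (y t)\<bar> < \<Delta> / 2"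
            if "solves_ode_on h y {0..T + 2}" "y 0 \<in> B" "t \<in> {0..T + 2}" "norm (w - y t) \<le> \<mu>" for y t w
            using \<mu>0(2)[OF that(1-3)] that(4) \<mu>(2) by auto
          show "a m \<le> 1" if "n0 \<le> m" for m using small1 that by blast
        qed
      qed
      then show False using \<omega> by simp
    qed
    have \<beta>_pos: "0 < \<beta> i" for i
    proof -
      have "0 < (a (ns i + 0))\<^sup>2" using step_pos[of "ns i + 0"] by simp
      also have "\<dots> \<le> \<beta> i" unfolding \<beta>_def using N(1)[of i] by (intro member_le_sum) auto
      finally show ?thesis .
    qed
    have \<beta>_part: "(\<Sum>i<k. \<beta> i) \<le> b" for k
    proof -
      have "mono ns" using ns_lt by (simp add: mono_iff_le_Suc less_imp_le)
      then have "(\<Sum>i<k. \<beta> i) = (\<Sum>l<ns k - ns 0. (a (ns 0 + l))\<^sup>2)"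
        unfolding \<beta>_def N_def by (rule sum_over_blocks)
      also have "\<dots> \<le> b"
        unfolding b_def ns_0 using summable_ignore_initial_segment[OF a_sq, of n0]
        by (intro sum_le_suminf) (auto simp: add.commute)
      finally show ?thesis .
    qed
    note series = sum_exp_le_exp_fourth_root[OF c \<beta>_pos \<beta>_part b1[folded b_def]]
    have bound_summable: "summable (\<lambda>i. K * prob A0 * exp (- (c / sqrt (\<beta> i))))"
      using series(1) by (rule summable_mult)
    have Bad_le': "prob (Bad i) \<le> K * prob A0 * exp (- (c / sqrt (\<beta> i)))" for i
      using Bad_le[of i] by (simp add: mult_ac)
    have Bad_summable: "summable (\<lambda>i. prob (Bad i))"
      by (rule summable_comparison_test'[OF bound_summable]) (use Bad_le' in auto)
    have "prob {\<omega> \<in> space P. x n0 \<omega> \<in> B \<and> \<not> confined n0 \<omega>} \<le> prob (\<Union>i. Bad i)"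
      using cover Bad_P by (intro finite_measure_mono) auto
    also have "\<dots> \<le> (\<Sum>i. prob (Bad i))"
      using Bad_P Bad_summable by (intro finite_measure_subadditive_countably) auto
    also have "\<dots> \<le> (\<Sum>i. K * prob A0 * exp (- (c / sqrt (\<beta> i))))"
      by (intro suminf_le Bad_le' Bad_summable bound_summable)
    also have "\<dots> = K * prob A0 * (\<Sum>i. exp (- (c / sqrt (\<beta> i))))"
      using series(1) by (rule suminf_mult)
    also have "\<dots> \<le> K * prob A0 * (8 / c\<^sup>2 * exp (- (c / 2 / root 4 b)))"
      using K series(2) by (intro mult_left_mono) auto
    finally show ?thesis by (simp add: A0_def b_def mult_ac)
  qed
  have "\<forall>\<^sub>F n0 in sequentially. prob {\<omega> \<in> space P. x n0 \<omega> \<in> B \<and> \<not> confined n0 \<omega>}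
      \<le> (K * (8 / c\<^sup>2)) * exp (- (c / 2 / root 4 (\<Sum>m. (a (n0 + m))\<^sup>2))) * prob {\<omega> \<in> space P. x n0 \<omega> \<in> B}"
    using eventually_step_le[OF \<alpha>] eventually_step_le[OF zero_less_one] eventually_tail_le_1
    by eventually_elim (rule main)
  moreover have "0 < K * (8 / c\<^sup>2)" "0 < c / 2" using K c by simp_all
  ultimately show ?thesis by blast
qed

end

theorem theorem12:
  fixes P :: "'w measure"
    and h :: "real ^ 'd \<Rightarrow> real ^ 'd"
    and V :: "real ^ 'd \<Rightarrow> real"
    and gradV :: "real ^ 'd \<Rightarrow> real ^ 'd"
    and B :: "(real ^ 'd) set"
    and a :: "nat \<Rightarrow> real"
    and x M :: "nat \<Rightarrow> 'w \<Rightarrow> real ^ 'd"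
    and T \<gamma>\<^sub>T C1 C2 \<delta>B K\<^sub>T \<epsilon> \<Delta> \<delta> \<gamma> :: real
  assumes P: "prob_space P"
    and V_nonneg: "\<And>z. 0 \<le> V z"
    and V_grad: "\<And>z. GDERIV V z :> gradV z"
    and V_coercive: "filterlim V at_top at_infinity"
    and V_descent: "\<And>z. gradV z \<bullet> h z \<le> 0"
    and H_eq: "{z. gradV z \<bullet> h z = 0} = {z. V z = 0}"
    and B: "bounded B" "open B" "{z. gradV z \<bullet> h z = 0} \<subseteq> B"
    and x0_meas: "x 0 \<in> borel_measurable P"
    and M_meas: "\<And>n. n \<ge> 1 \<Longrightarrow> M n \<in> borel_measurable P"
    and iterates: "\<And>n \<omega>. \<omega> \<in> space P \<Longrightarrow>
          x (Suc n) \<omega> = x n \<omega> + a n *\<^sub>R (h (x n \<omega>) + M (Suc n) \<omega>)"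
    and A1: "\<exists>L. L-lipschitz_on UNIV h"
    and A2: "\<And>n. a n > 0" "\<not> summable a" "summable (\<lambda>n. (a n)\<^sup>2)"
          "\<exists>c>0. \<forall>n m. n \<ge> m \<longrightarrow> a n \<le> c * a m"
    and A3_sq_int: "\<And>n. n \<ge> 1 \<Longrightarrow> integrable P (\<lambda>\<omega>. (norm (M n \<omega>))\<^sup>2)"
    and A3_mds: "\<And>n k. AE \<omega> in P.
          real_cond_exp P (noise_filtration P x M n) (\<lambda>\<omega>. M (Suc n) \<omega> $ k) \<omega> = 0"
    and A3_var: "\<exists>c>0. \<forall>n. AE \<omega> in P.
          real_cond_exp P (noise_filtration P x M n) (\<lambda>\<omega>. (norm (M (Suc n) \<omega>))\<^sup>2) \<omega>
            \<le> c * (1 + (norm (x n \<omega>))\<^sup>2)"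
    and T: "T > 0"
    and step_sizes: "\<gamma>\<^sub>T > 0"
          "\<And>n0 i m1 m2.
             block_start a T n0 i + m1 < block_start a T n0 (Suc i) \<Longrightarrow>
             block_start a T n0 i + m2 < block_start a T n0 (Suc i) \<Longrightarrow>
             a (block_start a T n0 i + m1) / a (block_start a T n0 i + m2) < \<gamma>\<^sub>T"
    and tail_bound: "C1 > 0" "C2 > 0"
          "\<exists>v0. \<forall>v\<ge>v0. \<forall>i. AE \<omega> in P.
             real_cond_exp P (noise_filtration P x M i)
               (indicator {\<omega> \<in> space P. norm (M (Suc i) \<omega>) / (1 + norm (x i \<omega>)) > v}) \<omega>
               \<le> C1 * exp (- C2 * v)"
    and \<delta>B: "\<delta>B > 0"
          "\<And>n0 i \<omega>. \<omega> \<in> space P \<Longrightarrow>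
             x (block_start a T n0 i) \<omega> \<in> B \<Longrightarrow>
             block_error a T h (\<lambda>n. x n \<omega>) n0 i < \<delta>B \<Longrightarrow>
             x (block_start a T n0 (Suc i)) \<omega> \<in> B"
    and K\<^sub>T: "K\<^sub>T > 0"
          "\<forall>\<^sub>F n0 in sequentially. \<forall>i.
             \<P>(\<omega> in P. good_before B \<delta>B a T h (\<lambda>n. x n \<omega>) n0 i) > 0 \<longrightarrow>
             \<P>(\<omega> in P. block_error a T h (\<lambda>n. x n \<omega>) n0 i \<ge> \<delta>B
                  \<bar> good_before B \<delta>B a T h (\<lambda>n. x n \<omega>) n0 i)
             \<le> \<P>(\<omega> in P. block_noise a T (\<lambda>n. M n \<omega>) n0 i > \<delta>
                  \<bar> good_before B \<delta>B a T h (\<lambda>n. x n \<omega>) n0 i)"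
    and \<epsilon>: "\<epsilon> > 0" "sublevel V \<epsilon> \<subseteq> closed_sublevel V \<epsilon>" "closed_sublevel V \<epsilon> \<subseteq> B"
    and \<Delta>: "\<Delta> > 0"
          "\<And>y s. s > T \<Longrightarrow> solves_ode_on h y {0..s} \<Longrightarrow> y 0 \<in> closure B - sublevel V \<epsilon> \<Longrightarrow>
             V (y s) < V (y 0) - \<Delta>"
    and \<delta>: "\<delta> > 0" "\<delta> = \<delta>B / (2 * K\<^sub>T)" "nbhd \<delta> (sublevel V \<epsilon>) \<subseteq> B"
          "\<And>z w. z \<in> closure B \<Longrightarrow> w \<in> closure B \<Longrightarrow> norm (z - w) < \<delta> \<Longrightarrow>
             \<bar>V z - V w\<bar> < \<Delta> / 2"
    and \<gamma>: "\<gamma> = ((SUP z\<in>closure B. V z) - \<epsilon>) / (\<Delta> / 2) * (T + 1)"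
  shows "\<exists>c1>0. \<exists>c>0. \<forall>\<^sub>F n0 in sequentially.
           \<P>(\<omega> in P. x n0 \<omega> \<in> B) > 0 \<longrightarrow>
           \<P>(\<omega> in P. \<forall>t \<ge> sa_time a n0 + \<gamma>.
                 interpolate a (\<lambda>n. x n \<omega>) t \<in> nbhd \<delta> (sublevel V (\<epsilon> + \<Delta> / 2))
              \<bar> x n0 \<omega> \<in> B)
           \<ge> 1 - c1 * exp (- (c * \<delta> powr (2/3) / root 4 (\<Sum>m. (a (n0 + m))\<^sup>2)))"
proof -
  interpret prob_space P by (rule P)
  obtain L where L: "L-lipschitz_on UNIV h" using A1 by blast
  interpret lyapunov_approximation P a h x M C1 C2 V gradV B L T \<epsilon> \<Delta>
  proof
    show "continuous_on UNIV h" using L by (rule lipschitz_on_continuous_on)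
  qed (use assms L in \<open>auto simp: sublevel_def closed_sublevel_def\<close>)
  define confined where "confined n0 \<omega> \<longleftrightarrow> (\<forall>t \<ge> sa_time a n0 + \<gamma>.
      interpolate a (\<lambda>n. x n \<omega>) t \<in> nbhd \<delta> (sublevel V (\<epsilon> + \<Delta> / 2)))" for n0 \<omega>
  obtain c1 c where c: "0 < c1" "0 < c" and fail: "\<forall>\<^sub>F n0 in sequentially.
      measure P {\<omega> \<in> space P. x n0 \<omega> \<in> B \<and> \<not> confined n0 \<omega>}
      \<le> c1 * exp (- (c / root 4 (\<Sum>m. (a (n0 + m))\<^sup>2))) * measure P {\<omega> \<in> space P. x n0 \<omega> \<in> B}"
    using failure_probability[OF \<delta>(1) \<delta>B] unfolding confined_def \<gamma> by blast
  \<comment> \<open>The radius \<open>\<delta>\<close> is fixed, so its power in the exponent is a constant factor.\<close>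
  define c' where "c' = c / \<delta> powr (2/3)"
  have c': "0 < c'" and c'_eq: "c' * \<delta> powr (2/3) = c" using c(2) \<delta>(1) by (simp_all add: c'_def)
  have meas: "{\<omega> \<in> space P. confined n0 \<omega>} \<in> sets P" if "0 < measure P {\<omega> \<in> space P. x n0 \<omega> \<in> B}" for n0
    unfolding confined_def
  proof (rule eventually_confined_measurable)
    show "open (nbhd \<delta> (sublevel V (\<epsilon> + \<Delta> / 2)))" by (auto simp: nbhd_def)
    have "B \<noteq> {}" using that by auto
    then have "0 \<le> \<gamma>" using \<epsilon>_le_Sup \<Delta>_pos T_pos by (simp add: \<gamma>)
    then show "0 \<le> sa_time a n0 + \<gamma>" using sa_time_nonneg[of n0] by linarith
  qed simp
  have "\<forall>\<^sub>F n0 in sequentially. \<P>(\<omega> in P. x n0 \<omega> \<in> B) > 0 \<longrightarrow>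
      \<P>(\<omega> in P. confined n0 \<omega> \<bar> x n0 \<omega> \<in> B)
        \<ge> 1 - c1 * exp (- (c' * \<delta> powr (2/3) / root 4 (\<Sum>m. (a (n0 + m))\<^sup>2)))"
    using fail
  proof eventually_elim
    case (elim n0)
    define A0 where "A0 = {\<omega> \<in> space P. x n0 \<omega> \<in> B}"
    define G where "G = {\<omega> \<in> space P. confined n0 \<omega> \<and> x n0 \<omega> \<in> B}"
    define q where "q = c1 * exp (- (c / root 4 (\<Sum>m. (a (n0 + m))\<^sup>2)))"
    show ?case
    proof
      assume pos: "0 < measure P {\<omega> \<in> space P. x n0 \<omega> \<in> B}"
      have [measurable]: "B \<in> sets borel" using B(2) by simp
      have A0: "A0 \<in> sets P" unfolding A0_def by measurable
      have "G = {\<omega> \<in> space P. confined n0 \<omega>} \<inter> A0" by (auto simp: G_def A0_def)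
      then have G: "G \<in> sets P" using meas[OF pos] A0 by simp
      have "A0 - G = {\<omega> \<in> space P. x n0 \<omega> \<in> B \<and> \<not> confined n0 \<omega>}" by (auto simp: A0_def G_def)
      moreover have "measure P (A0 - G) = measure P A0 - measure P G"
        using A0 G by (intro finite_measure_Diff) (auto simp: G_def A0_def)
      ultimately have "measure P A0 - measure P G \<le> q * measure P A0"
        using elim by (simp add: A0_def q_def)
      then have "(1 - q) * measure P A0 \<le> measure P G" by (simp add: algebra_simps)
      then have "1 - q \<le> measure P G / measure P A0" using pos by (simp add: A0_def pos_le_divide_eq)
      then show "1 - c1 * exp (- (c' * \<delta> powr (2/3) / root 4 (\<Sum>m. (a (n0 + m))\<^sup>2)))
          \<le> \<P>(\<omega> in P. confined n0 \<omega> \<bar> x n0 \<omega> \<in> B)"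
        unfolding cond_prob_def c'_eq q_def G_def A0_def .
    qed
  qed
  then show ?thesis using c(1) c' unfolding confined_def by blast
qed

end
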